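(* Let $k$ be an algebraically closed field and let $X\subset\mathbb{P}^n_k$ be a Cohen–Macaulay scheme of pure dimension $d$ that is generically a complete intersection. Let $Z=\mathbb{V}(F_1,\dots,F_{n-d})$ be the complete intersection constructed from homogeneous generators of the ideal of $X$, linear forms $\ell_i$ and coefficients $b_{i,j}\in k$ as in the context. Then for the generic point $\eta$ of each irreducible component of $X$ there is a non-trivial genericity condition on the coefficients $b_{i,j}$ such that $\mathcal I_{Z,\eta}=\mathcal I_{X,\eta}$.
   Context: $X$ is generically a complete intersection if for each generic point $\eta$ of an irreducible component of $X$ the ideal $(\mathcal I_X)_\eta$ is generated by $n-d$ elements in the local ring $\mathcal O_{\mathbb{P}^n_k,\eta}$. Here $\mathcal I_X$, $\mathcal I_Z$ denote the ideal sheaves of $X$, $Z$ on $\mathbb{P}^n_k$. A genericity condition on the $b_{i,j}$ means the non-vanishing of a polynomial in the $b_{i,j}$. Construction. Let $I_X=(f_1,\dots,f_r)\subset k[x_0,\dots,x_n]$ be the homogeneous ideal of $X$, with $d_i=\deg f_i$ and $d_1\ge\dots\ge d_r$. If $n=d+1$, then $I_X$ is principal and one sets $Z=X$. If $n\ge d+2$, one selects linear forms $\ell_1,\dots,\ell_{n-d-1}$ and constants $b_{i,j}\in k$ ($1\le i\le n-d$, $i\le j\le r$), subject to the general conditions below, and puts $$F_1=\sum_{j=1}^rb_{1,j}\ell_1^{d_1-d_j}f_j,\qquad F_i=\sum_{j=i}^rb_{i,j}\ell_{i-1}^{d_i-d_j}f_j\quad(2\le i\le n-d).$$ The choices are made inductively: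 $\ell_1$ avoids the minimal primes of $(f_1)$; for $2\le i\le n-d-1$ the form $\ell_i$ avoids the minimal primes of $(F_1,\dots,F_i)$; and for $2\le i\le n-d$ the $b_{i,j}$ are general, so that $F_i$ avoids the minimal primes of $(F_1,\dots,F_{i-1})$ (possible by prime avoidance). Then $Z=\mathbb{V}(F_1,\dots,F_{n-d})$ is a complete intersection containing $X$, with $F_i\in(I_X)_{d_i}$.
   Formalization: The linear forms ℓ_i are additionally assumed not to vanish at the generic point η considered; the avoidance conditions listed in the construction do not imply this, and without it the claim fails (e.g. for the ideal (c, xy, yz) in P² with c and ℓ_1 forms in x, z). *)

theory Defs
  imports
    "HOL-Library.Poly_Mapping"
    "HOL-Library.Extended_Nat"
    "HOL-Computational_Algebra.Polynomial"
    "HOL-Computational_Algebra.Fraction_Field"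
    "HOL-Algebra.QuotRing"
    "HOL-Algebra.Ring_Divisibility"
begin

section \<open>The homogeneous coordinate ring\<close>

text \<open>
  Polynomials have indeterminates indexed by the natural numbers; the coordinate ring
  \<open>k[x\<^sub>0,\<dots>,x\<^sub>n]\<close> is the subring of those involving only \<open>x\<^sub>0,\<dots>,x\<^sub>n\<close>.
\<close>

type_synonym ('v, 'k) mpoly = "('v \<Rightarrow>\<^sub>0 nat) \<Rightarrow>\<^sub>0 'k"

definition mpoly_over :: "'v set \<Rightarrow> ('v, 'k::zero) mpoly set" where
  "mpoly_over V = {p. \<forall>m\<in>Poly_Mapping.keys p. Poly_Mapping.keys m \<subseteq> V}"

definition eval_mpoly :: "('v, 'k::comm_semiring_1) mpoly \<Rightarrow> ('v \<Rightarrow> 'k) \<Rightarrow> 'k" where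
  "eval_mpoly p b =
     (\<Sum>m\<in>Poly_Mapping.keys p.
        Poly_Mapping.lookup p m * (\<Prod>v\<in>Poly_Mapping.keys m. b v ^ Poly_Mapping.lookup m v))"

definition coord_ring :: "nat \<Rightarrow> (nat, 'k::field) mpoly ring" where
  "coord_ring n =
     \<lparr>carrier = mpoly_over {..n}, mult = (*), one = 1, zero = 0, add = (+)\<rparr>"

definition Var :: "nat \<Rightarrow> (nat, 'k::field) mpoly" where
  "Var i = Poly_Mapping.single (Poly_Mapping.single i 1) 1"

definition Const :: "'k \<Rightarrow> (nat, 'k::field) mpoly" where
  "Const c = Poly_Mapping.single 0 c"

definition monom_degree :: "('v \<Rightarrow>\<^sub>0 nat) \<Rightarrow> nat" where
  "monom_degree m = (\<Sum>v\<in>Poly_Mapping.keys m. Poly_Mapping.lookup m v)"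

text \<open>The graded piece of degree \<open>e\<close>; it contains \<open>0\<close>.\<close>

definition forms :: "nat \<Rightarrow> nat \<Rightarrow> (nat, 'k::field) mpoly set" where
  "forms n e =
     {p \<in> carrier (coord_ring n). \<forall>m\<in>Poly_Mapping.keys p. monom_degree m = e}"

definition homogeneous_ideal :: "nat \<Rightarrow> (nat, 'k::field) mpoly set \<Rightarrow> bool" where
  "homogeneous_ideal n J \<longleftrightarrow>
     ideal J (coord_ring n) \<and> J = Idl\<^bsub>coord_ring n\<^esub> (J \<inter> (\<Union>e. forms n e))"

definition minimal_prime_over :: "('a, 'b) ring_scheme \<Rightarrow> 'a set \<Rightarrow> 'a set \<Rightarrow> bool" where
  "minimal_prime_over R J p \<longleftrightarrow>
     primeideal p R \<and> J \<subseteq> p \<and> (\<forall>q. primeideal q R \<and> J \<subseteq> q \<and> q \<subseteq> p \<longrightarrow> q = p)"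

definition avoids_minimal_primes ::
    "('a, 'b) ring_scheme \<Rightarrow> 'a \<Rightarrow> 'a set \<Rightarrow> bool" where
  "avoids_minimal_primes R g J \<longleftrightarrow> (\<forall>p. minimal_prime_over R J p \<longrightarrow> g \<notin> p)"


section \<open>Projective space as a topological space\<close>

text \<open>
  Scheme-theoretic points of \<open>\<P>\<^sup>n = Proj k[x\<^sub>0,\<dots>,x\<^sub>n]\<close>: the homogeneous primes that do not
  contain the irrelevant ideal.
\<close>

definition proj_points :: "nat \<Rightarrow> (nat, 'k::field) mpoly set set" where
  "proj_points n =
     {p. primeideal p (coord_ring n) \<and> homogeneous_ideal n p \<and> (\<exists>i\<le>n. Var i \<notin> p)}"

definition vanishing_locus ::
    "nat \<Rightarrow> (nat, 'k::field) mpoly set \<Rightarrow> (nat, 'k) mpoly set set" where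
  "vanishing_locus n J = {p \<in> proj_points n. J \<subseteq> p}"

definition zariski_closed :: "nat \<Rightarrow> (nat, 'k::field) mpoly set set \<Rightarrow> bool" where
  "zariski_closed n C \<longleftrightarrow> (\<exists>J. homogeneous_ideal n J \<and> C = vanishing_locus n J)"

definition irreducible_closed :: "nat \<Rightarrow> (nat, 'k::field) mpoly set set \<Rightarrow> bool" where
  "irreducible_closed n C \<longleftrightarrow> zariski_closed n C \<and> C \<noteq> {} \<and>
     (\<forall>A B. zariski_closed n A \<and> zariski_closed n B \<and> C = A \<union> B \<longrightarrow> C = A \<or> C = B)"

definition is_generic_point ::
    "nat \<Rightarrow> (nat, 'k::field) mpoly set set \<Rightarrow> (nat, 'k) mpoly set \<Rightarrow> bool" where
  "is_generic_point n C \<eta> \<longleftrightarrow> \<eta> \<in> C \<and> C = \<Inter>{A. zariski_closed n A \<and> \<eta> \<in> A}"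

definition top_dim :: "nat \<Rightarrow> (nat, 'k::field) mpoly set set \<Rightarrow> enat" where
  "top_dim n C = Sup {enat m | m. \<exists>Z. (\<forall>i\<le>m. irreducible_closed n (Z i) \<and> Z i \<subseteq> C) \<and>
                                       (\<forall>i<m. Z i \<subset> Z (Suc i))}"


section \<open>Closed subschemes\<close>

text \<open>
  A closed subscheme \<open>X\<close> of \<open>\<P>\<^sup>n\<close> is represented by its homogeneous ideal \<open>I\<^sub>X\<close>, via the usual
  bijection between closed subschemes and saturated homogeneous ideals.
\<close>

definition saturated :: "nat \<Rightarrow> (nat, 'k::field) mpoly set \<Rightarrow> bool" where
  "saturated n I \<longleftrightarrow>
     (\<forall>g\<in>carrier (coord_ring n). (\<forall>i\<le>n. \<exists>N. Var i ^ N * g \<in> I) \<longrightarrow> g \<in> I)"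

definition closed_subscheme :: "nat \<Rightarrow> (nat, 'k::field) mpoly set \<Rightarrow> bool" where
  "closed_subscheme n I \<longleftrightarrow> homogeneous_ideal n I \<and> saturated n I"

definition irreducible_component ::
    "nat \<Rightarrow> (nat, 'k::field) mpoly set \<Rightarrow> (nat, 'k) mpoly set set \<Rightarrow> bool" where
  "irreducible_component n I C \<longleftrightarrow> irreducible_closed n C \<and> C \<subseteq> vanishing_locus n I \<and>
     (\<forall>D. irreducible_closed n D \<and> D \<subseteq> vanishing_locus n I \<and> C \<subseteq> D \<longrightarrow> D = C)"

definition pure_dimensional :: "nat \<Rightarrow> (nat, 'k::field) mpoly set \<Rightarrow> nat \<Rightarrow> bool" where
  "pure_dimensional n I d \<longleftrightarrow> (\<forall>C. irreducible_component n I C \<longrightarrow> top_dim n C = enat d)"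

text \<open>
  For a homogeneous ideal \<open>J\<close>, the stalk at \<open>p\<close> of the associated ideal sheaf is the degree-zero
  part of the homogeneous localization of \<open>J\<close>, realised inside the fraction field. The structure
  sheaf is the case where \<open>J\<close> is the whole coordinate ring.
\<close>

definition ideal_stalk ::
    "nat \<Rightarrow> (nat, 'k::field) mpoly set \<Rightarrow> (nat, 'k) mpoly set \<Rightarrow> (nat, 'k) mpoly fract set" where
  "ideal_stalk n J p =
     {Fract a b | a b e. a \<in> J \<inter> forms n e \<and> b \<in> forms n e \<and> b \<notin> p}"

definition proj_local_ring ::
    "nat \<Rightarrow> (nat, 'k::field) mpoly set \<Rightarrow> (nat, 'k) mpoly fract ring" where
  "proj_local_ring n p =
     \<lparr>carrier = ideal_stalk n (carrier (coord_ring n)) p,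
      mult = (*), one = 1, zero = 0, add = (+)\<rparr>"

definition subscheme_local_ring ::
    "nat \<Rightarrow> (nat, 'k::field) mpoly set \<Rightarrow> (nat, 'k) mpoly set \<Rightarrow>
       (nat, 'k) mpoly fract set ring" where
  "subscheme_local_ring n I p = proj_local_ring n p Quot ideal_stalk n I p"

definition generically_complete_intersection ::
    "nat \<Rightarrow> nat \<Rightarrow> (nat, 'k::field) mpoly set \<Rightarrow> bool" where
  "generically_complete_intersection n d I \<longleftrightarrow>
     (\<forall>C \<eta>. irreducible_component n I C \<and> is_generic_point n C \<eta> \<longrightarrow>
        (\<exists>gs. length gs = n - d \<and> set gs \<subseteq> carrier (proj_local_ring n \<eta>) \<and>
              ideal_stalk n I \<eta> = Idl\<^bsub>proj_local_ring n \<eta>\<^esub> (set gs)))"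


section \<open>Cohen--Macaulay schemes\<close>

definition krull_dim :: "('a, 'b) ring_scheme \<Rightarrow> enat" where
  "krull_dim R = Sup {enat m | m. \<exists>P. (\<forall>i\<le>m. primeideal (P i) R) \<and> (\<forall>i<m. P i \<subset> P (Suc i))}"

definition regular_sequence :: "('a, 'b) ring_scheme \<Rightarrow> 'a list \<Rightarrow> bool" where
  "regular_sequence R xs \<longleftrightarrow> set xs \<subseteq> carrier R \<and> Idl\<^bsub>R\<^esub> (set xs) \<noteq> carrier R \<and>
     (\<forall>i<length xs. \<forall>y\<in>carrier R.
        xs ! i \<otimes>\<^bsub>R\<^esub> y \<in> Idl\<^bsub>R\<^esub> (set (take i xs)) \<longrightarrow> y \<in> Idl\<^bsub>R\<^esub> (set (take i xs)))"

definition local_depth :: "('a, 'b) ring_scheme \<Rightarrow> 'a set \<Rightarrow> enat" where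
  "local_depth R m = Sup {enat (length xs) | xs. regular_sequence R xs \<and> set xs \<subseteq> m}"

definition cohen_macaulay_local_ring :: "('a, 'b) ring_scheme \<Rightarrow> bool" where
  "cohen_macaulay_local_ring R \<longleftrightarrow> cring R \<and> noetherian_ring R \<and>
     (\<exists>m. maximalideal m R \<and> (\<forall>m'. maximalideal m' R \<longrightarrow> m' = m) \<and>
          local_depth R m = krull_dim R)"

definition cohen_macaulay_scheme :: "nat \<Rightarrow> (nat, 'k::field) mpoly set \<Rightarrow> bool" where
  "cohen_macaulay_scheme n I \<longleftrightarrow>
     (\<forall>p\<in>vanishing_locus n I. cohen_macaulay_local_ring (subscheme_local_ring n I p))"


section \<open>The complete intersection containing a subscheme\<close>

text \<open>
  \<open>f\<close> is a list of homogeneous generators indexed by \<open>1,\<dots>,r\<close>, and \<open>dg j = deg f\<^sub>j\<close>.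
\<close>

definition homogeneous_generators ::
    "nat \<Rightarrow> (nat, 'k::field) mpoly set \<Rightarrow> nat \<Rightarrow> (nat \<Rightarrow> (nat, 'k) mpoly) \<Rightarrow>
       (nat \<Rightarrow> nat) \<Rightarrow> bool" where
  "homogeneous_generators n I r f dg \<longleftrightarrow>
     (\<forall>j\<in>{1..r}. f j \<noteq> 0 \<and> f j \<in> forms n (dg j)) \<and>
     I = Idl\<^bsub>coord_ring n\<^esub> (f ` {1..r}) \<and>
     (\<forall>i\<in>{1..r}. \<forall>j\<in>{1..r}. i \<le> j \<longrightarrow> dg j \<le> dg i)"

text \<open>
  The form \<open>F\<^sub>i\<close>. Both \<open>F\<^sub>1\<close> and \<open>F\<^sub>2\<close> are built with \<open>L\<^sub>1\<close>; in general \<open>F\<^sub>i\<close> with \<open>i \<ge> 2\<close> uses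
  \<open>L\<^bsub>i-1\<^esub>\<close>.
\<close>

definition CI_form ::
    "nat \<Rightarrow> (nat \<Rightarrow> (nat, 'k::field) mpoly) \<Rightarrow> (nat \<Rightarrow> nat) \<Rightarrow> (nat \<Rightarrow> (nat, 'k) mpoly) \<Rightarrow>
       (nat \<times> nat \<Rightarrow> 'k) \<Rightarrow> nat \<Rightarrow> (nat, 'k) mpoly" where
  "CI_form r f dg L b i =
     (\<Sum>j=i..r. Const (b (i, j)) * L (if i = 1 then 1 else i - 1) ^ (dg i - dg j) * f j)"

definition coeff_indices :: "nat \<Rightarrow> nat \<Rightarrow> nat \<Rightarrow> (nat \<times> nat) set" where
  "coeff_indices n d r = {(i, j). 1 \<le> i \<and> i \<le> n - d \<and> i \<le> j \<and> j \<le> r}"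

text \<open>
  The avoidance conditions imposed in the inductive choice of the \<open>L\<^sub>i\<close> and \<open>b\<^bsub>i,j\<^esub>\<close>. They do not
  prevent \<open>L\<^sub>i\<close> from vanishing at a generic point of \<open>X\<close>: for \<open>(x,z) \<inter> (y,c)\<close> in \<open>k[x,y,z]\<close>, with \<open>c\<close>
  a product of three distinct linear forms in \<open>x,z\<close> and generators \<open>c, x y, y z\<close>, a linear form
  \<open>L\<^sub>1\<close> in \<open>x,z\<close> not dividing \<open>c\<close> is allowed, but then \<open>F\<^sub>1\<close> lies in \<open>(x,z)\<^sup>2\<close> for every choice of the
  coefficients. Genericity of the \<open>L\<^sub>i\<close> in this respect has to be assumed separately.
\<close>

definition admissible_choice ::
    "nat \<Rightarrow> nat \<Rightarrow> nat \<Rightarrow> (nat \<Rightarrow> (nat, 'k::field) mpoly) \<Rightarrow> (nat \<Rightarrow> nat) \<Rightarrow>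
       (nat \<Rightarrow> (nat, 'k) mpoly) \<Rightarrow> (nat \<times> nat \<Rightarrow> 'k) \<Rightarrow> bool" where
  "admissible_choice n d r f dg L b \<longleftrightarrow>
     (let R = coord_ring n; F = CI_form r f dg L b in
       n \<ge> d + 2 \<longrightarrow>
         avoids_minimal_primes R (L 1) (Idl\<^bsub>R\<^esub> {f 1}) \<and>
         (\<forall>i. 2 \<le> i \<and> i \<le> n - d - 1 \<longrightarrow> avoids_minimal_primes R (L i) (Idl\<^bsub>R\<^esub> (F ` {1..i}))) \<and>
         (\<forall>i. 2 \<le> i \<and> i \<le> n - d \<longrightarrow> avoids_minimal_primes R (F i) (Idl\<^bsub>R\<^esub> (F ` {1..i-1}))))"

text \<open>
  A homogeneous ideal defining \<open>Z\<close>. For \<open>n = d + 1\<close> no choices are made and \<open>Z = X\<close>.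
\<close>

definition CI_ideal ::
    "nat \<Rightarrow> nat \<Rightarrow> (nat, 'k::field) mpoly set \<Rightarrow> nat \<Rightarrow> (nat \<Rightarrow> (nat, 'k) mpoly) \<Rightarrow>
       (nat \<Rightarrow> nat) \<Rightarrow> (nat \<Rightarrow> (nat, 'k) mpoly) \<Rightarrow> (nat \<times> nat \<Rightarrow> 'k) \<Rightarrow> (nat, 'k) mpoly set" where
  "CI_ideal n d I r f dg L b =
     (if n = d + 1 then I else Idl\<^bsub>coord_ring n\<^esub> (CI_form r f dg L b ` {1..n-d}))"

end

theory Submission
  imports Defs "Jordan_Normal_Form.Determinant"
begin

text \<open>
  Let \<open>R\<close> be the local ring at \<open>\<eta>\<close>, with maximal ideal \<open>M\<close>, and put \<open>c = n - d\<close>. Since \<open>L\<^sub>1\<close> is a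
  unit at \<open>\<eta>\<close>, the ideal of \<open>X\<close> in \<open>R\<close> is generated by \<open>\<phi>\<^sub>j = f\<^sub>j / L\<^sub>1 ^ d\<^sub>j\<close>; by hypothesis it has \<open>c\<close>
  generators. In a local ring these can be exchanged one by one for some of the \<open>\<phi>\<^sub>j\<close>, so \<open>m \<le> c\<close> of
  them, with indices \<open>j\<^sub>1 < \<dots> < j\<^sub>m\<close>, already generate. Writing \<open>F\<^sub>1, \<dots>, F\<^sub>m\<close>, up to units, in terms of
  these gives a square matrix \<open>A(b)\<close> over \<open>R\<close>, linear in \<open>b\<close>, and the \<open>F\<^sub>i\<close> generate as soon as
  \<open>det A(b) \<notin> M\<close>. This happens for \<open>b\<^bsub>s,j\<^sub>s\<^esub> = 1\<close> and all other coefficients zero, because \<open>s \<le> j\<^sub>s\<close>. A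
  \<open>k\<close>-linear functional that kills \<open>M\<close> but not this value turns \<open>det A(b)\<close> into the polynomial
  over \<open>k\<close> that is looked for.
\<close>

section \<open>Linear combinations over a subring\<close>

text \<open>Adding one term at a time lets \<open>S\<close> be infinite and a generator occur
  repeatedly, and inclusions between spans follow by induction. Families of coefficients are
  recovered only where needed, by \<open>lin_comb_imageE\<close>.\<close>

inductive_set lin_comb :: "'a::comm_ring_1 set \<Rightarrow> 'a set \<Rightarrow> 'a set" for R S where
  zero: "0 \<in> lin_comb R S"
| step: "c \<in> R \<Longrightarrow> x \<in> S \<Longrightarrow> y \<in> lin_comb R S \<Longrightarrow> c * x + y \<in> lin_comb R S"

lemma lin_comb_add: "x \<in> lin_comb R S \<Longrightarrow> y \<in> lin_comb R S \<Longrightarrow> x + y \<in> lin_comb R S"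
  by (induction rule: lin_comb.induct) (auto simp: add.assoc intro: lin_comb.step)

lemma lin_comb_sum: "(\<And>i. i \<in> A \<Longrightarrow> g i \<in> lin_comb R S) \<Longrightarrow> (\<Sum>i\<in>A. g i) \<in> lin_comb R S"
  by (induction A rule: infinite_finite_induct) (auto intro: lin_comb_add lin_comb.zero)

lemma lin_comb_mono: "S \<subseteq> T \<Longrightarrow> lin_comb R S \<subseteq> lin_comb R T"
proof
  fix x assume "S \<subseteq> T" "x \<in> lin_comb R S"
  from this(2,1) show "x \<in> lin_comb R T"
    by (induction rule: lin_comb.induct) (auto intro: lin_comb.intros)
qed

text \<open>The link from sets inside a type-class ring to HOL-Algebra: \<open>coord_ring n\<close>
  and \<open>proj_local_ring n \<eta>\<close> both have this shape, so the same lemmas serve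
  both.\<close>

definition as_ring :: "'a::comm_ring_1 set \<Rightarrow> 'a ring" where
  "as_ring R = \<lparr>carrier = R, mult = (*), one = 1, zero = 0, add = (+)\<rparr>"

locale comm_subring =
  fixes R :: "'a::comm_ring_1 set"
  assumes one_closed: "1 \<in> R"
    and add_closed: "x \<in> R \<Longrightarrow> y \<in> R \<Longrightarrow> x + y \<in> R"
    and mult_closed: "x \<in> R \<Longrightarrow> y \<in> R \<Longrightarrow> x * y \<in> R"
    and uminus_closed: "x \<in> R \<Longrightarrow> - x \<in> R"
begin

lemma zero_closed: "0 \<in> R"
  using add_closed[OF one_closed uminus_closed[OF one_closed]] by simp

lemma sum_closed: "(\<And>i. i \<in> A \<Longrightarrow> g i \<in> R) \<Longrightarrow> (\<Sum>i\<in>A. g i) \<in> R"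
  by (induction A rule: infinite_finite_induct) (auto intro: zero_closed add_closed)

lemma prod_closed: "(\<And>i. i \<in> A \<Longrightarrow> g i \<in> R) \<Longrightarrow> (\<Prod>i\<in>A. g i) \<in> R"
  by (induction A rule: infinite_finite_induct) (auto intro: one_closed mult_closed)

lemma power_closed: "x \<in> R \<Longrightarrow> x ^ k \<in> R"
  by (induction k) (auto intro: one_closed mult_closed)

lemma signof_closed: "signof p \<in> R"
  by (auto simp: sign_def intro: one_closed uminus_closed)

lemma det_closed:
  assumes A: "A \<in> carrier_mat m m" and "\<And>i j. i < m \<Longrightarrow> j < m \<Longrightarrow> A $$ (i, j) \<in> R"
  shows "det A \<in> R"
  unfolding det_def'[OF A]
proof (intro sum_closed mult_closed prod_closed signof_closed)
  fix p i assume "p \<in> {p. p permutes {0..<m}}" and i: "i \<in> {0..<m}"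
  then have "p i \<in> {0..<m}" by (simp add: permutes_in_image[of p])
  with i show "A $$ (i, p i) \<in> R" using assms(2) by simp
qed

text \<open>The entries of the adjugate are signed minors, so Cramer's rule stays inside
  \<open>R\<close> up to division by the determinant.\<close>

lemma adj_mat_closed:
  assumes A: "A \<in> carrier_mat m m" and R: "\<And>i j. i < m \<Longrightarrow> j < m \<Longrightarrow> A $$ (i, j) \<in> R"
    and ij: "i < m" "j < m"
  shows "adj_mat A $$ (i, j) \<in> R"
proof -
  have "det (mat_delete A j i) \<in> R"
    by (rule det_closed[where m = "m - 1"]) (use A R ij in \<open>auto simp: mat_delete_def\<close>)
  moreover have "(-1) ^ (j + i) \<in> R"
    by (intro power_closed uminus_closed one_closed)
  ultimately show ?thesis
    using A ij unfolding adj_mat_def cofactor_def by (auto intro: mult_closed)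
qed

lemma lin_comb_base: "x \<in> S \<Longrightarrow> x \<in> lin_comb R S"
  using lin_comb.step[OF one_closed _ lin_comb.zero, of x S] by simp

lemma lin_comb_mult: "a \<in> R \<Longrightarrow> x \<in> lin_comb R S \<Longrightarrow> a * x \<in> lin_comb R S"
  by (rotate_tac, induction rule: lin_comb.induct)
    (auto simp: distrib_left mult.assoc[symmetric] intro: lin_comb.intros mult_closed)

lemma lin_comb_uminus: "x \<in> lin_comb R S \<Longrightarrow> - x \<in> lin_comb R S"
  using lin_comb_mult[OF uminus_closed[OF one_closed], of x S] by simp

lemma lin_comb_trans: "S \<subseteq> lin_comb R T \<Longrightarrow> lin_comb R S \<subseteq> lin_comb R T"
proof
  fix x assume "S \<subseteq> lin_comb R T" "x \<in> lin_comb R S"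
  from this(2,1) show "x \<in> lin_comb R T"
    by (induction rule: lin_comb.induct) (auto intro: lin_comb.zero lin_comb_add lin_comb_mult)
qed

lemma lin_comb_subset: "S \<subseteq> R \<Longrightarrow> lin_comb R S \<subseteq> R"
proof
  fix x assume "S \<subseteq> R" "x \<in> lin_comb R S"
  from this(2,1) show "x \<in> R"
    by (induction rule: lin_comb.induct) (auto intro: zero_closed add_closed mult_closed)
qed

text \<open>All occurrences of \<open>g\<close> are collected in one coefficient, even if
  \<open>g\<close> also lies in \<open>T\<close>. The exchange argument asks whether this
  coefficient is a unit.\<close>

lemma lin_comb_insertE:
  assumes "x \<in> lin_comb R (insert g T)"
  obtains c y where "c \<in> R" "y \<in> lin_comb R T" "x = c * g + y"
proof -
  from assms have "\<exists>c\<in>R. \<exists>y\<in>lin_comb R T. x = c * g + y"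
  proof (induction rule: lin_comb.induct)
    case zero
    show ?case by (intro bexI[of _ 0]) (auto intro: zero_closed lin_comb.zero)
  next
    case (step c x y)
    then obtain c' y' where *: "c' \<in> R" "y' \<in> lin_comb R T" "y = c' * g + y'" by blast
    show ?case
    proof (cases "x = g")
      case True
      then have "c * x + y = (c + c') * g + y'" by (simp add: * algebra_simps)
      then show ?thesis using * step.hyps(1) add_closed by blast
    next
      case False
      then have "c * x + y' \<in> lin_comb R T" using step * by (auto intro: lin_comb.step)
      moreover have "c * x + y = c' * g + (c * x + y')" by (simp add: * algebra_simps)
      ultimately show ?thesis using * by blast
    qed
  qed
  then show ?thesis using that by blast
qed

lemma lin_comb_imageE:
  assumes "x \<in> lin_comb R (\<phi> ` A)" "finite A"
  obtains c where "\<And>i. i \<in> A \<Longrightarrow> c i \<in> R" "x = (\<Sum>i\<in>A. c i * \<phi> i)"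
proof -
  from assms have "\<exists>c. (\<forall>i\<in>A. c i \<in> R) \<and> x = (\<Sum>i\<in>A. c i * \<phi> i)"
  proof (induction rule: lin_comb.induct)
    case zero
    show ?case by (intro exI[of _ "\<lambda>_. 0"]) (auto intro: zero_closed)
  next
    case (step a x y)
    then obtain c i where *: "\<forall>i\<in>A. c i \<in> R" "y = (\<Sum>i\<in>A. c i * \<phi> i)" "i \<in> A" "x = \<phi> i" by blast
    \<comment> \<open>If \<phi> takes the value \<open>x\<close> at several indices, the new
      coefficient goes to the one chosen index \<open>i\<close>.\<close>
    have "(\<Sum>j\<in>A. (c j + (if j = i then a else 0)) * \<phi> j)
        = (\<Sum>j\<in>A. c j * \<phi> j) + (\<Sum>j\<in>A. if j = i then a * \<phi> j else 0)"
      unfolding sum.distrib[symmetric] by (rule sum.cong) (auto simp: algebra_simps)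
    also have "\<dots> = a * x + y"
      using * step.prems by simp
    finally show ?case
      using * step.hyps(1)
      by (intro exI[of _ "\<lambda>j. c j + (if j = i then a else 0)"]) (auto intro: add_closed)
  qed
  then show ?thesis using that by blast
qed

section \<open>Ideals of a subring in the sense of HOL-Algebra\<close>

lemma cring_as_ring: "cring (as_ring R)"
proof (rule cringI)
  show "abelian_group (as_ring R)"
    by (rule abelian_groupI)
      (auto simp: as_ring_def add_closed zero_closed algebra_simps intro!: bexI[of _ "- _"] uminus_closed)
  show "comm_monoid (as_ring R)"
    by (rule comm_monoidI) (auto simp: as_ring_def mult_closed one_closed algebra_simps)
qed (auto simp: as_ring_def algebra_simps)

lemma ideal_as_ringD:
  assumes "ideal J (as_ring R)"
  shows "J \<subseteq> R" "0 \<in> J" "x \<in> J \<Longrightarrow> y \<in> J \<Longrightarrow> x + y \<in> J" "a \<in> R \<Longrightarrow> x \<in> J \<Longrightarrow> a * x \<in> J"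
proof -
  interpret ideal J "as_ring R" by fact
  show "J \<subseteq> R" using a_subset by (simp add: as_ring_def)
  show "0 \<in> J" using additive_subgroup.zero_closed[OF is_additive_subgroup] by (simp add: as_ring_def)
  show "x \<in> J \<Longrightarrow> y \<in> J \<Longrightarrow> x + y \<in> J" using additive_subgroup.a_closed[OF is_additive_subgroup, of x y]
    by (simp add: as_ring_def)
  show "a \<in> R \<Longrightarrow> x \<in> J \<Longrightarrow> a * x \<in> J" using I_l_closed[of x a] by (simp add: as_ring_def)
qed

text \<open>The span is an ideal containing \<open>S\<close>, and every ideal containing
  \<open>S\<close> absorbs each step of the inductive construction of the span.\<close>

lemma genideal_as_ring:
  assumes "S \<subseteq> R"
  shows "Idl\<^bsub>as_ring R\<^esub> S = lin_comb R S"
proof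
  interpret cring "as_ring R" by (rule cring_as_ring)
  have "ideal (lin_comb R S) (as_ring R)"
  proof (rule idealI)
    show "subgroup (lin_comb R S) (add_monoid (as_ring R))"
    proof (rule group.subgroupI[OF a_group])
      fix x assume x: "x \<in> lin_comb R S"
      then have "x \<in> R" using lin_comb_subset[OF assms] by blast
      then have "\<ominus>\<^bsub>as_ring R\<^esub> x = - x"
        by (intro minus_equality) (auto simp: as_ring_def uminus_closed)
      then show "inv\<^bsub>add_monoid (as_ring R)\<^esub> x \<in> lin_comb R S"
        using x by (simp add: a_inv_def lin_comb_uminus)
    qed (use lin_comb_subset[OF assms] in \<open>auto simp: as_ring_def intro: lin_comb_add lin_comb.zero\<close>)
    show "ring (as_ring R)" by (rule ring_axioms)
  next
    fix a x assume "a \<in> lin_comb R S" "x \<in> carrier (as_ring R)"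
    then have "x * a \<in> lin_comb R S" by (intro lin_comb_mult) (auto simp: as_ring_def)
    then show "x \<otimes>\<^bsub>as_ring R\<^esub> a \<in> lin_comb R S" "a \<otimes>\<^bsub>as_ring R\<^esub> x \<in> lin_comb R S"
      by (simp_all add: as_ring_def mult.commute)
  qed
  then show "Idl\<^bsub>as_ring R\<^esub> S \<subseteq> lin_comb R S"
    by (rule genideal_minimal) (auto intro: lin_comb_base)
  have J: "ideal (Idl\<^bsub>as_ring R\<^esub> S) (as_ring R)"
    using assms by (intro genideal_ideal) (simp add: as_ring_def)
  have S: "S \<subseteq> Idl\<^bsub>as_ring R\<^esub> S"
    using assms by (intro genideal_self) (simp add: as_ring_def)
  have "x \<in> Idl\<^bsub>as_ring R\<^esub> S" if "x \<in> lin_comb R S" for x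
    using that S by (induction rule: lin_comb.induct) (auto intro: ideal_as_ringD[OF J])
  then show "lin_comb R S \<subseteq> Idl\<^bsub>as_ring R\<^esub> S" by blast
qed

end

section \<open>Generators of ideals in a local ring\<close>

text \<open>Since \<open>M\<close> is a proper ideal and everything in \<open>R\<close> outside it
  has its inverse, taken in the ambient field, again in \<open>R\<close>, the ring \<open>R\<close>
  is local with maximal ideal \<open>M\<close>.\<close>

locale local_subring = comm_subring R for R :: "'a::field set" +
  fixes M :: "'a set"
  assumes M_subset: "M \<subseteq> R"
    and M_zero: "0 \<in> M"
    and M_add: "x \<in> M \<Longrightarrow> y \<in> M \<Longrightarrow> x + y \<in> M"
    and M_mult: "a \<in> R \<Longrightarrow> x \<in> M \<Longrightarrow> a * x \<in> M"
    and M_one: "1 \<notin> M"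
    and inverse_closed: "x \<in> R \<Longrightarrow> x \<notin> M \<Longrightarrow> inverse x \<in> R"
begin

lemma inverse_mult_cancel: "(x::'a) \<noteq> 0 \<Longrightarrow> inverse x * (x * y) = y"
  by (subst mult.assoc[symmetric], subst left_inverse) auto

lemma nonM_mult:
  assumes "x \<in> R" "x \<notin> M" "y \<in> R" "y \<notin> M"
  shows "x * y \<notin> M"
proof
  assume "x * y \<in> M"
  then have "inverse x * (x * y) \<in> M" by (rule M_mult[OF inverse_closed[OF assms(1,2)]])
  moreover have "x \<noteq> 0" using assms(2) M_zero by metis
  then have "inverse x * (x * y) = y" by (rule inverse_mult_cancel)
  ultimately show False using assms(4) by metis
qed

lemma nonM_prod: "(\<And>i. i \<in> A \<Longrightarrow> g i \<in> R - M) \<Longrightarrow> (\<Prod>i\<in>A. g i) \<in> R - M"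
  by (induction A rule: infinite_finite_induct)
    (auto simp: one_closed M_one mult_closed nonM_mult)

text \<open>If every \<open>\<phi> \<in> \<Phi>\<close> had its coefficient at \<open>g\<close> in the maximal ideal \<open>M\<close>, then so would
  \<open>g\<close> itself, and \<open>g\<close> would be redundant; otherwise some \<open>\<phi>\<close> can be solved for \<open>g\<close>.\<close>

lemma exchange:
  assumes eq: "lin_comb R (insert g T) = lin_comb R \<Phi>"
  shows "lin_comb R T = lin_comb R \<Phi> \<or> (\<exists>\<phi>\<in>\<Phi>. lin_comb R (insert \<phi> T) = lin_comb R \<Phi>)"
proof (cases "\<exists>\<phi>\<in>\<Phi>. \<exists>c\<in>R - M. \<exists>t\<in>lin_comb R T. \<phi> = c * g + t")
  case True
  then obtain \<phi> c t where *: "\<phi> \<in> \<Phi>" "c \<in> R" "c \<notin> M" "t \<in> lin_comb R T" "\<phi> = c * g + t" by blast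
  then have c: "c \<noteq> 0" "inverse c \<in> R" using M_zero inverse_closed by auto
  have "inverse c * (\<phi> + - t) \<in> lin_comb R (insert \<phi> T)"
    using *(4) c lin_comb_mono[of T "insert \<phi> T" R]
    by (intro lin_comb_mult lin_comb_add lin_comb_uminus) (auto intro: lin_comb_base)
  moreover have "\<phi> + - t = c * g" by (simp add: *(5))
  ultimately have "g \<in> lin_comb R (insert \<phi> T)" by (simp only: inverse_mult_cancel[OF c(1)])
  then have "insert g T \<subseteq> lin_comb R (insert \<phi> T)" by (auto intro: lin_comb_base)
  moreover have "insert \<phi> T \<subseteq> lin_comb R \<Phi>"
    using *(1) eq by (auto intro: lin_comb_base)
  ultimately have "lin_comb R (insert \<phi> T) = lin_comb R \<Phi>"
    using eq lin_comb_trans by blast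
  then show ?thesis using * by blast
next
  case False
  have M: "\<exists>c\<in>M. \<exists>t\<in>lin_comb R T. x = c * g + t" if "x \<in> lin_comb R \<Phi>" for x
    using that
  proof (induction rule: lin_comb.induct)
    case zero
    show ?case by (intro bexI[of _ 0]) (auto intro: M_zero lin_comb.zero)
  next
    case (step a x y)
    have "x \<in> lin_comb R (insert g T)" using step eq by (simp add: lin_comb_base)
    then obtain c t where *: "c \<in> R" "t \<in> lin_comb R T" "x = c * g + t"
      by (rule lin_comb_insertE)
    then have "c \<in> M" using False step by blast
    obtain c' t' where **: "c' \<in> M" "t' \<in> lin_comb R T" "y = c' * g + t'"
      using step by blast
    have "a * x + y = (a * c + c') * g + (a * t + t')"
      by (simp add: * ** algebra_simps)
    moreover have "a * c + c' \<in> M" using \<open>c \<in> M\<close> ** step by (intro M_add M_mult)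
    moreover have "a * t + t' \<in> lin_comb R T" using * ** step by (intro lin_comb_add lin_comb_mult)
    ultimately show ?case by blast
  qed
  have "g \<in> lin_comb R \<Phi>" using eq by (auto intro: lin_comb_base)
  then obtain c t where *: "c \<in> M" "t \<in> lin_comb R T" "g = c * g + t" using M by blast
  \<comment> \<open>As in Nakayama's lemma: \<open>(1 - c) * g = t\<close>, and \<open>1 - c\<close>
    is a unit because \<open>c\<close> lies in the maximal ideal.\<close>
  have "1 - c \<notin> M" using M_add[OF _ *(1), of "1 - c"] M_one by auto
  moreover have "1 - c \<in> R"
    using * M_subset add_closed[OF one_closed uminus_closed, of c] by auto
  ultimately have c: "1 - c \<noteq> 0" "inverse (1 - c) \<in> R" using M_zero inverse_closed by auto
  have "inverse (1 - c) * t \<in> lin_comb R T" using * c by (intro lin_comb_mult)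
  moreover have "(1 - c) * g = t" using *(3) by (simp add: algebra_simps)
  then have "inverse (1 - c) * t = g" using inverse_mult_cancel[OF c(1), of g] by (simp only:)
  ultimately have "g \<in> lin_comb R T" by (simp only:)
  then have "insert g T \<subseteq> lin_comb R T" by (auto intro: lin_comb_base)
  then have "lin_comb R T = lin_comb R \<Phi>"
    using eq lin_comb_trans lin_comb_mono[of T "insert g T"] by blast
  then show ?thesis by blast
qed

text \<open>\<open>S\<close> holds the elements of \<Phi> exchanged so far. The cardinality is only
  bounded, since an element of \<open>G\<close> may turn out redundant and the new \<phi> may
  already belong to \<open>S\<close>.\<close>

lemma exchange_all:
  assumes "finite G" "finite S" "S \<subseteq> \<Phi>" "lin_comb R (G \<union> S) = lin_comb R \<Phi>"
  shows "\<exists>S'\<subseteq>\<Phi>. finite S' \<and> card S' \<le> card G + card S \<and> lin_comb R S' = lin_comb R \<Phi>"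
  using assms
proof (induction G arbitrary: S rule: finite_induct)
  case empty
  then show ?case by auto
next
  case (insert g G)
  from insert.prems(3) have "lin_comb R (insert g (G \<union> S)) = lin_comb R \<Phi>" by simp
  from exchange[OF this] consider "lin_comb R (G \<union> S) = lin_comb R \<Phi>"
    | \<phi> where "\<phi> \<in> \<Phi>" "lin_comb R (G \<union> insert \<phi> S) = lin_comb R \<Phi>" by auto
  then show ?case
  proof cases
    case 1
    from insert.IH[OF insert.prems(1,2) this] obtain S' where
      "S' \<subseteq> \<Phi>" "finite S'" "card S' \<le> card G + card S" "lin_comb R S' = lin_comb R \<Phi>"
      by blast
    then show ?thesis using insert.hyps by (intro exI[of _ S']) simp
  next
    case 2
    from insert.IH[OF _ _ this(2)] insert.prems this(1) obtain S' where
      "S' \<subseteq> \<Phi>" "finite S'" "card S' \<le> card G + card (insert \<phi> S)" "lin_comb R S' = lin_comb R \<Phi>"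
      by auto
    moreover have "card (insert \<phi> S) \<le> Suc (card S)" by (rule card_insert_le_m1) auto
    ultimately show ?thesis using insert.hyps by (intro exI[of _ S']) simp
  qed
qed

text \<open>Cramer's rule: multiplying \<psi> = A \<phi> by the adjugate gives det A times \<phi>,
  and det A is a unit of \<open>R\<close>.\<close>

lemma generators_from_det:
  assumes A: "A \<in> carrier_mat m m" and R: "\<And>i j. i < m \<Longrightarrow> j < m \<Longrightarrow> A $$ (i, j) \<in> R"
    and det: "det A \<notin> M"
    and \<psi>: "\<And>i. i < m \<Longrightarrow> \<psi> i = (\<Sum>s<m. A $$ (i, s) * \<phi> s)"
    and "t < m"
  shows "\<phi> t \<in> lin_comb R (\<psi> ` {..<m})"
proof -
  have "det A \<in> R" using det_closed[OF A R] .
  then have d: "det A \<noteq> 0" "inverse (det A) \<in> R" using det M_zero inverse_closed by auto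
  have adj: "adj_mat A \<in> carrier_mat m m" by (rule adj_mat(1)[OF A])
  have entry: "(\<Sum>i<m. adj_mat A $$ (t, i) * A $$ (i, s)) = (if s = t then det A else 0)" if "s < m" for s
  proof -
    have "(\<Sum>i<m. adj_mat A $$ (t, i) * A $$ (i, s)) = (adj_mat A * A) $$ (t, s)"
      using that \<open>t < m\<close> A adj by (auto simp: scalar_prod_def lessThan_atLeast0)
    also have "\<dots> = (if s = t then det A else 0)"
      using that \<open>t < m\<close> adj_mat(3)[OF A] by auto
    finally show ?thesis .
  qed
  have "(\<Sum>i<m. adj_mat A $$ (t, i) * \<psi> i) = (\<Sum>i<m. \<Sum>s<m. adj_mat A $$ (t, i) * A $$ (i, s) * \<phi> s)"
    by (intro sum.cong) (auto simp: \<psi> sum_distrib_left mult.assoc)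
  also have "\<dots> = (\<Sum>s<m. (\<Sum>i<m. adj_mat A $$ (t, i) * A $$ (i, s)) * \<phi> s)"
    by (subst sum.swap) (simp add: sum_distrib_right)
  also have "\<dots> = (\<Sum>s<m. if s = t then det A * \<phi> s else 0)"
    by (intro sum.cong) (auto simp: entry)
  also have "\<dots> = det A * \<phi> t" using \<open>t < m\<close> by simp
  finally have "\<phi> t = inverse (det A) * (\<Sum>i<m. adj_mat A $$ (t, i) * \<psi> i)"
    using d by simp
  also have "\<dots> \<in> lin_comb R (\<psi> ` {..<m})"
    using d adj_mat_closed[OF A R \<open>t < m\<close>]
    by (intro lin_comb_mult lin_comb_sum lin_comb_base) auto
  finally show ?thesis .
qed

end

section \<open>Evaluation of polynomials\<close>

text \<open>At a key that is not yet present, an update is the addition of a single term; this form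
  suits additive maps.\<close>

lemma poly_mapping_add_induct [case_names zero add]:
  assumes "P 0" and "\<And>a b p. P p \<Longrightarrow> P (Poly_Mapping.single a b + p)"
  shows "P (p :: 'x \<Rightarrow>\<^sub>0 'y::comm_monoid_add)"
proof (induction p rule: update_induct)
  case (update f a b)
  have "Poly_Mapping.update a b f = Poly_Mapping.single a b + f"
    using update.hyps
    by (intro poly_mapping_eqI) (auto simp: lookup_update lookup_add lookup_single when_def in_keys_iff)
  then show ?case using update assms by metis
qed (use assms in auto)

text \<open>Cancellation can make the keys of a sum smaller than the union of the keys. A common
  index set with zero coefficients allows the sums to be compared termwise.\<close>

lemma eval_mpoly_superset:
  assumes "finite A" "Poly_Mapping.keys p \<subseteq> A"
  shows "eval_mpoly p b =
    (\<Sum>m\<in>A. Poly_Mapping.lookup p m * (\<Prod>v\<in>Poly_Mapping.keys m. b v ^ Poly_Mapping.lookup m v))"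
  unfolding eval_mpoly_def using assms
  by (intro sum.mono_neutral_left) (auto simp: in_keys_iff)

lemma eval_mpoly_zero [simp]: "eval_mpoly 0 b = 0"
  by (simp add: eval_mpoly_def)

lemma eval_mpoly_add: "eval_mpoly (p + q) b = eval_mpoly p b + eval_mpoly q b"
proof -
  have "Poly_Mapping.keys (p + q) \<subseteq> Poly_Mapping.keys p \<union> Poly_Mapping.keys q"
    by (rule Poly_Mapping.keys_add)
  then show ?thesis
    by (simp add: eval_mpoly_superset[of "Poly_Mapping.keys p \<union> Poly_Mapping.keys q"]
        lookup_add distrib_right sum.distrib)
qed

lemma eval_mpoly_single:
  "eval_mpoly (Poly_Mapping.single m c) b =
     c * (\<Prod>v\<in>Poly_Mapping.keys m. b v ^ Poly_Mapping.lookup m v)"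
  by (subst eval_mpoly_superset[of "{m}"]) auto

lemma monomial_value_add:
  fixes m m' :: "'v \<Rightarrow>\<^sub>0 nat" and b :: "'v \<Rightarrow> 'k::comm_semiring_1"
  shows "(\<Prod>v\<in>Poly_Mapping.keys (m + m'). b v ^ Poly_Mapping.lookup (m + m') v) =
    (\<Prod>v\<in>Poly_Mapping.keys m. b v ^ Poly_Mapping.lookup m v) *
    (\<Prod>v\<in>Poly_Mapping.keys m'. b v ^ Poly_Mapping.lookup m' v)"
proof -
  have *: "(\<Prod>v\<in>Poly_Mapping.keys m. b v ^ Poly_Mapping.lookup m v) =
      (\<Prod>v\<in>A. b v ^ Poly_Mapping.lookup m v)"
    if "finite A" "Poly_Mapping.keys m \<subseteq> A" for A and m :: "'v \<Rightarrow>\<^sub>0 nat"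
    using that by (intro prod.mono_neutral_left) (auto simp: in_keys_iff)
  let ?A = "Poly_Mapping.keys m \<union> Poly_Mapping.keys m'"
  have "Poly_Mapping.keys (m + m') \<subseteq> ?A" by (rule Poly_Mapping.keys_add)
  then show ?thesis
    by (subst (1 2 3) *[of ?A]) (simp_all add: lookup_add power_add prod.distrib)
qed

text \<open>Multiplicativity is required for a single variable as left factor, since the polynomials
  in the coefficients are built up one variable at a time.\<close>

lemma eval_mpoly_mult_single:
  "eval_mpoly (Poly_Mapping.single m c * p) b =
     eval_mpoly (Poly_Mapping.single m c) b * eval_mpoly p b"
proof (induction p rule: poly_mapping_add_induct)
  case (add a x p)
  then show ?case
    by (simp add: distrib_left eval_mpoly_add mult_single eval_mpoly_single monomial_value_add mult_ac)
qed auto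

section \<open>Polynomials in a given set of variables\<close>

lemma mpoly_over_zero [simp]: "0 \<in> mpoly_over V"
  by (simp add: mpoly_over_def)

lemma mpoly_over_add: "p \<in> mpoly_over V \<Longrightarrow> q \<in> mpoly_over V \<Longrightarrow> p + q \<in> mpoly_over V"
  unfolding mpoly_over_def using Poly_Mapping.keys_add[of p q] by blast

lemma mpoly_over_mult:
  fixes p q :: "('v, 'k::semiring_0) mpoly"
  assumes "p \<in> mpoly_over V" "q \<in> mpoly_over V"
  shows "p * q \<in> mpoly_over V"
proof -
  have "Poly_Mapping.keys m \<subseteq> V" if m: "m \<in> Poly_Mapping.keys (p * q)" for m
  proof -
    from m obtain a c where "m = a + c" "a \<in> Poly_Mapping.keys p" "c \<in> Poly_Mapping.keys q"
      using keys_mult[of p q] by blast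
    then show ?thesis using assms Poly_Mapping.keys_add[of a c] unfolding mpoly_over_def by blast
  qed
  then show ?thesis by (simp add: mpoly_over_def)
qed

lemma mpoly_over_single: "Poly_Mapping.keys m \<subseteq> V \<Longrightarrow> Poly_Mapping.single m c \<in> mpoly_over V"
  by (simp add: mpoly_over_def)

section \<open>Generic combinations of generators\<close>

text \<open>The map \<iota> stands for the inclusion of the constants. It makes the ambient field a
  vector space over \<open>'k\<close> with \<open>M\<close> as a subspace.\<close>

locale local_algebra = local_subring R M for R M :: "'a::field set" +
  fixes \<iota> :: "'k::field \<Rightarrow> 'a"
  assumes \<iota>_add: "\<iota> (x + y) = \<iota> x + \<iota> y"
    and \<iota>_mult: "\<iota> (x * y) = \<iota> x * \<iota> y"
    and \<iota>_one: "\<iota> 1 = 1"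
    and \<iota>_closed: "\<iota> x \<in> R"
begin

definition functional :: "('a \<Rightarrow> 'k) \<Rightarrow> bool" where
  "functional h \<longleftrightarrow> (\<forall>x y. h (x + y) = h x + h y) \<and> (\<forall>c x. h (\<iota> c * x) = c * h x)"

lemma \<iota>_zero: "\<iota> 0 = 0"
  using \<iota>_add[of 0 0] by (metis add.right_neutral add_left_cancel)

text \<open>The residue field of \<open>R\<close> may be larger than \<open>'k\<close>, so reduction
  modulo \<open>M\<close> need not give a scalar. Instead, a basis of \<open>M\<close> stays
  independent when \<open>x\<close> is added, and the values 0 on the basis and 1 at
  \<open>x\<close> extend linearly.\<close>

lemma exists_functional:
  assumes "x \<notin> M"
  obtains h where "functional h" "\<And>y. y \<in> M \<Longrightarrow> h y = 0" "h x = 1"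
proof -
  interpret v1: vector_space "\<lambda>c x. \<iota> c * x"
    by standard (simp_all add: \<iota>_add \<iota>_mult \<iota>_one algebra_simps)
  interpret v2: vector_space "(*) :: 'k \<Rightarrow> 'k \<Rightarrow> 'k"
    by standard (simp_all add: algebra_simps)
  interpret vector_space_pair "\<lambda>c x. \<iota> c * x" "(*) :: 'k \<Rightarrow> 'k \<Rightarrow> 'k" ..
  have sub: "v1.subspace M"
    by (rule v1.subspaceI) (auto intro: M_zero M_add M_mult \<iota>_closed)
  obtain B where B: "B \<subseteq> M" "v1.independent B" "M \<subseteq> v1.span B"
    using v1.maximal_independent_subset[of M] by metis
  have "v1.span B \<subseteq> M" by (rule v1.span_minimal[OF B(1) sub])
  then have "v1.independent (insert x B)"
    using assms B(2) by (intro v1.independent_insertI) auto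
  then obtain h where h: "Vector_Spaces.linear (\<lambda>c x. \<iota> c * x) (*) h"
      "\<forall>y\<in>insert x B. h y = (if y = x then 1 else 0)"
    using linear_independent_extend[of "insert x B" "\<lambda>y. if y = x then 1 else 0"] by blast
  have "h y = 0" if "y \<in> M" for y
    using that B(1,3) h assms
    by (intro linear_eq_0_on_span[OF h(1), of B y]) auto
  moreover have "functional h"
    unfolding functional_def using linear_add[OF h(1)] linear_scale[OF h(1)] by blast
  ultimately show ?thesis using that h(2) by auto
qed

text \<open>Polynomial functions with coefficients in \<open>'a\<close>, described through the \<open>'k\<close>-polynomials
  obtained by applying a linear functional to the coefficients.\<close>

definition poly_function :: "'v set \<Rightarrow> (('v \<Rightarrow> 'k) \<Rightarrow> 'a) \<Rightarrow> bool" where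
  "poly_function V D \<longleftrightarrow>
     (\<forall>h. functional h \<longrightarrow> (\<exists>P\<in>mpoly_over V. \<forall>b. eval_mpoly P b = h (D b)))"

lemma poly_function_const: "poly_function V (\<lambda>_. a)"
  unfolding poly_function_def
proof (intro allI impI)
  fix h assume "functional h"
  show "\<exists>P\<in>mpoly_over V. \<forall>b. eval_mpoly P b = h a"
    by (rule bexI[of _ "Poly_Mapping.single 0 (h a)"])
      (auto simp: eval_mpoly_single intro: mpoly_over_single)
qed

lemma poly_function_add:
  assumes "poly_function V D" "poly_function V E"
  shows "poly_function V (\<lambda>b. D b + E b)"
  unfolding poly_function_def
proof (intro allI impI)
  fix h assume h: "functional h"
  obtain P Q where "P \<in> mpoly_over V" "\<forall>b. eval_mpoly P b = h (D b)"
    "Q \<in> mpoly_over V" "\<forall>b. eval_mpoly Q b = h (E b)"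
    using assms h unfolding poly_function_def by meson
  then show "\<exists>P\<in>mpoly_over V. \<forall>b. eval_mpoly P b = h (D b + E b)"
    using h by (intro bexI[of _ "P + Q"]) (auto simp: eval_mpoly_add functional_def intro: mpoly_over_add)
qed

text \<open>The factor \<open>a\<close> need not be a constant, so it cannot be pulled out of
  \<open>h\<close>; but \<open>h (a * x)\<close> is again a functional of \<open>x\<close>. This is
  why \<open>poly_function\<close> quantifies over all functionals.\<close>

lemma poly_function_scale:
  assumes "poly_function V D"
  shows "poly_function V (\<lambda>b. a * D b)"
  unfolding poly_function_def
proof (intro allI impI)
  fix h assume "functional h"
  then have "functional (\<lambda>x. h (a * x))"
    unfolding functional_def by (metis distrib_left mult.left_commute)
  then show "\<exists>P\<in>mpoly_over V. \<forall>b. eval_mpoly P b = h (a * D b)"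
    using assms unfolding poly_function_def by blast
qed

lemma poly_function_var:
  fixes V :: "'v set"
  assumes "poly_function V D" "v \<in> V"
  shows "poly_function V (\<lambda>b. \<iota> (b v) * D b)"
  unfolding poly_function_def
proof (intro allI impI)
  fix h assume h: "functional h"
  obtain P where P: "P \<in> mpoly_over V" "\<forall>b. eval_mpoly P b = h (D b)"
    using assms h unfolding poly_function_def by meson
  let ?X = "Poly_Mapping.single (Poly_Mapping.single v 1) 1 :: ('v, 'k) mpoly"
  have "?X * P \<in> mpoly_over V"
    using P assms by (intro mpoly_over_mult mpoly_over_single) auto
  moreover have "eval_mpoly (?X * P) b = h (\<iota> (b v) * D b)" for b
    using h P by (simp add: eval_mpoly_mult_single eval_mpoly_single functional_def)
  ultimately show "\<exists>P\<in>mpoly_over V. \<forall>b. eval_mpoly P b = h (\<iota> (b v) * D b)" by blast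
qed

lemma poly_function_sum:
  "(\<And>i. i \<in> A \<Longrightarrow> poly_function V (D i)) \<Longrightarrow> poly_function V (\<lambda>b. \<Sum>i\<in>A. D i b)"
  by (induction A rule: infinite_finite_induct) (auto intro: poly_function_const poly_function_add)

text \<open>Functionals are not multiplicative, so products are formed one linear factor at a time,
  each factor being expanded into terms treated by \<open>poly_function_var\<close>.\<close>

lemma poly_function_mult_linear:
  assumes "poly_function V D" "\<And>j. j \<in> J \<Longrightarrow> v j \<in> V"
  shows "poly_function V (\<lambda>b. (\<Sum>j\<in>J. \<iota> (b (v j)) * a j) * D b)"
  unfolding sum_distrib_right mult.assoc
  using assms by (intro poly_function_sum poly_function_var poly_function_scale) auto

lemma poly_function_prod_linear:
  assumes "finite A" "\<And>i j. i \<in> A \<Longrightarrow> j \<in> J i \<Longrightarrow> v i j \<in> V"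
  shows "poly_function V (\<lambda>b. \<Prod>i\<in>A. \<Sum>j\<in>J i. \<iota> (b (v i j)) * a i j)"
  using assms
  by (induction A rule: finite_induct) (auto intro: poly_function_const poly_function_mult_linear)

text \<open>Every product in the Leibniz formula takes one entry from each row, and each entry is
  linear in \<open>b\<close>.\<close>

lemma poly_function_det:
  assumes "\<And>i j. i < m \<Longrightarrow> j \<in> J i \<Longrightarrow> v i j \<in> V"
  shows "poly_function V (\<lambda>b. det (mat m m (\<lambda>(i, s). \<Sum>j\<in>J i. \<iota> (b (v i j)) * a i j s)))"
proof -
  have "det (mat m m (\<lambda>(i, s). \<Sum>j\<in>J i. \<iota> (b (v i j)) * a i j s)) =
      (\<Sum>p\<in>{p. p permutes {0..<m}}.
         signof p * (\<Prod>i\<in>{0..<m}. \<Sum>j\<in>J i. \<iota> (b (v i j)) * a i j (p i)))" for b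
  proof (subst det_def'[of _ m], simp, intro sum.cong refl arg_cong2[of _ _ _ _ "(*)"] prod.cong)
    fix p i assume "p \<in> {p. p permutes {0..<m}}" and i: "i \<in> {0..<m}"
    then have "p i \<in> {0..<m}" by (simp add: permutes_in_image[of p])
    with i show "mat m m (\<lambda>(i, s). \<Sum>j\<in>J i. \<iota> (b (v i j)) * a i j s) $$ (i, p i) =
        (\<Sum>j\<in>J i. \<iota> (b (v i j)) * a i j (p i))" by simp
  qed
  then show ?thesis
    using assms by (auto intro!: poly_function_sum poly_function_scale poly_function_prod_linear)
qed

text \<open>With \<open>h\<close> chosen to be 1 at \<open>D b\<^sub>0\<close> and 0 on
  \<open>M\<close>, the polynomial for \<open>h (D b)\<close> does not vanish at
  \<open>b\<^sub>0\<close>, and where it does not vanish \<open>D b\<close> cannot lie in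
  \<open>M\<close>.\<close>

lemma generic_polynomial:
  assumes "poly_function V D" "D b\<^sub>0 \<notin> M"
  obtains P where "P \<noteq> 0" "P \<in> mpoly_over V" "\<And>b. eval_mpoly P b \<noteq> 0 \<Longrightarrow> D b \<notin> M"
proof -
  obtain h where h: "functional h" "\<And>y. y \<in> M \<Longrightarrow> h y = 0" "h (D b\<^sub>0) = 1"
    using exists_functional[OF assms(2)] by blast
  obtain P where P: "P \<in> mpoly_over V" "\<And>b. eval_mpoly P b = h (D b)"
    using assms(1) h(1) unfolding poly_function_def by blast
  have "eval_mpoly P b\<^sub>0 \<noteq> 0" by (simp add: P h)
  then have "P \<noteq> 0" by auto
  moreover have "D b \<notin> M" if "eval_mpoly P b \<noteq> 0" for b
    using that P(2) h(2) by metis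
  ultimately show ?thesis using that P(1) by blast
qed

text \<open>An increasing sequence
  \<open>j\<^sub>1 < \<dots> < j\<^sub>m\<close> of positive integers satisfies \<open>s \<le> j\<^sub>s\<close>, so the combinations can be specialised
  to unit multiples of the generators \<open>\<phi>\<^bsub>j\<^sub>s\<^esub>\<close>.\<close>

lemma generic_generators:
  fixes \<phi> :: "nat \<Rightarrow> 'a" and u :: "nat \<Rightarrow> nat \<Rightarrow> 'a"
  assumes \<phi>: "\<And>j. j \<in> {1..r} \<Longrightarrow> \<phi> j \<in> R"
    and G: "finite G" "card G \<le> c" "lin_comb R G = lin_comb R (\<phi> ` {1..r})"
    and u: "\<And>i j. i \<in> {1..c} \<Longrightarrow> j \<in> {i..r} \<Longrightarrow> u i j \<in> R - M"
  obtains P :: "(nat \<times> nat, 'k) mpoly"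
  where "P \<noteq> 0" "P \<in> mpoly_over {(i, j). 1 \<le> i \<and> i \<le> c \<and> i \<le> j \<and> j \<le> r}"
    "\<And>b. eval_mpoly P b \<noteq> 0 \<Longrightarrow>
       lin_comb R (\<phi> ` {1..r}) \<subseteq> lin_comb R ((\<lambda>i. \<Sum>j=i..r. \<iota> (b (i, j)) * u i j * \<phi> j) ` {1..c})"
proof -
  obtain S where S: "S \<subseteq> \<phi> ` {1..r}" "finite S" "card S \<le> card G"
      "lin_comb R S = lin_comb R (\<phi> ` {1..r})"
    using exchange_all[of G "{}" "\<phi> ` {1..r}"] G by auto
  \<comment> \<open>One index is chosen for each element of \<open>S\<close>, so that
    \<open>J\<close> and \<open>S\<close> have equal size even if some of the \<phi>
    coincide.\<close>
  obtain J where J: "J \<subseteq> {1..r}" "inj_on \<phi> J" "S = \<phi> ` J"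
    using S(1) by (auto simp: subset_image_inj)
  have finJ: "finite J" using J(1) finite_subset by blast
  define js where "js = sorted_list_of_set J"
  define m where "m = length js"
  define e where "e s = js ! s" for s
  have setjs: "set js = J" and sorted: "sorted_wrt (<) js" and "distinct js"
    using finJ by (simp_all add: js_def)
  have m: "m \<le> c"
    using S(3) G(2) J by (simp add: m_def js_def card_image)
  have e_img: "e ` {..<m} = J"
    using setjs by (auto simp: e_def m_def set_conv_nth)
  have e_inj: "e s = e t \<longleftrightarrow> s = t" if "s < m" "t < m" for s t
    using that \<open>distinct js\<close> by (simp add: e_def m_def nth_eq_iff_index_eq)
  have e_r: "e s \<in> {1..r}" if "s < m" for s
    using that e_img J(1) by blast
  have e_ge: "Suc s \<le> e s" if "s < m" for s
  proof -
    \<comment> \<open>In a strictly increasing list of naturals the entry at position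
      \<open>t\<close> is at least \<open>t\<close>. Prepending 0 shifts positions by one, as
      \<open>js\<close> is counted from 0 and its entries are positive.\<close>
    have "sorted_wrt (<) (0 # js)" using sorted setjs J(1) by auto
    from sorted_wrt_less_idx[OF this, of "Suc s"] that show ?thesis by (simp add: e_def m_def)
  qed
  have img: "(\<lambda>s. \<phi> (e s)) ` {..<m} = S" using e_img J(3) by auto
  \<comment> \<open>Coefficients with respect to the selected generators need not be unique. For a
    selected generator the unit vector is prescribed, which makes the specialised matrix
    diagonal.\<close>
  have "\<exists>k. (\<forall>s<m. k s \<in> R) \<and> \<phi> j = (\<Sum>s<m. k s * \<phi> (e s)) \<and>
      (\<forall>t<m. j = e t \<longrightarrow> (\<forall>s<m. k s = (if s = t then 1 else 0)))" if "j \<in> {1..r}" for j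
  proof (cases "j \<in> J")
    case True
    then obtain t where t: "t < m" "j = e t" using e_img by auto
    have "(\<Sum>s<m. (if s = t then 1 else 0) * \<phi> (e s)) = (\<Sum>s<m. if s = t then \<phi> (e s) else 0)"
      by (intro sum.cong) auto
    also have "\<dots> = \<phi> (e t)" using t by simp
    finally have sum: "(\<Sum>s<m. (if s = t then 1 else 0) * \<phi> (e s)) = \<phi> (e t)" .
    show ?thesis
      by (rule exI[of _ "\<lambda>s. if s = t then 1 else 0"])
        (use t e_inj in \<open>auto simp: sum one_closed zero_closed\<close>)
  next
    case False
    have "\<phi> j \<in> lin_comb R ((\<lambda>s. \<phi> (e s)) ` {..<m})"
      unfolding img S(4) using that by (intro lin_comb_base) auto
    then obtain k where "\<And>s. s \<in> {..<m} \<Longrightarrow> k s \<in> R" "\<phi> j = (\<Sum>s<m. k s * \<phi> (e s))"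
      by (rule lin_comb_imageE) auto
    then show ?thesis using False e_img by (intro exI[of _ k]) auto
  qed
  then obtain N where N: "\<And>j s. j \<in> {1..r} \<Longrightarrow> s < m \<Longrightarrow> N j s \<in> R"
      "\<And>j. j \<in> {1..r} \<Longrightarrow> \<phi> j = (\<Sum>s<m. N j s * \<phi> (e s))"
      "\<And>s t. s < m \<Longrightarrow> t < m \<Longrightarrow> N (e t) s = (if s = t then 1 else 0)"
    using e_r by metis
  define V where "V = {(i, j). 1 \<le> i \<and> i \<le> c \<and> i \<le> j \<and> j \<le> r}"
  \<comment> \<open>Row \<open>i\<close>, counted from 0, belongs to the combination with index
    \<open>Suc i\<close>, and column \<open>s\<close> to the generator \<phi> at \<open>e s\<close>.
    Only the first \<open>m\<close> of the \<open>c\<close> combinations enter.\<close>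
  define A where "A b = mat m m (\<lambda>(i, s). \<Sum>j\<in>{Suc i..r}. \<iota> (b (Suc i, j)) * (u (Suc i) j * N j s))"
    for b :: "nat \<times> nat \<Rightarrow> 'k"
  define \<psi> where "\<psi> b i = (\<Sum>j=i..r. \<iota> (b (i, j)) * u i j * \<phi> j)" for b :: "nat \<times> nat \<Rightarrow> 'k" and i
  have carr: "A b \<in> carrier_mat m m" for b by (simp add: A_def)
  have A_R: "A b $$ (i, s) \<in> R" if "i < m" "s < m" for b i s
    using that m N(1) u unfolding A_def
    by (auto intro!: sum_closed mult_closed \<iota>_closed)
  have \<psi>_A: "\<psi> b (Suc i) = (\<Sum>s<m. A b $$ (i, s) * \<phi> (e s))" if "i < m" for b i
  proof -
    have "\<psi> b (Suc i) = (\<Sum>j=Suc i..r. \<Sum>s<m. \<iota> (b (Suc i, j)) * (u (Suc i) j * N j s) * \<phi> (e s))"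
      unfolding \<psi>_def
    proof (rule sum.cong[OF refl])
      fix j assume "j \<in> {Suc i..r}"
      then have "\<phi> j = (\<Sum>s<m. N j s * \<phi> (e s))" by (intro N(2)) auto
      then show "\<iota> (b (Suc i, j)) * u (Suc i) j * \<phi> j =
          (\<Sum>s<m. \<iota> (b (Suc i, j)) * (u (Suc i) j * N j s) * \<phi> (e s))"
        by (simp add: sum_distrib_left mult.assoc)
    qed
    also have "\<dots> = (\<Sum>s<m. \<Sum>j=Suc i..r. \<iota> (b (Suc i, j)) * (u (Suc i) j * N j s) * \<phi> (e s))"
      by (rule sum.swap)
    also have "\<dots> = (\<Sum>s<m. A b $$ (i, s) * \<phi> (e s))"
      using that by (intro sum.cong) (auto simp: A_def sum_distrib_right)
    finally show ?thesis .
  qed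
  have "poly_function V (\<lambda>b. det (A b))"
    unfolding A_def using m by (intro poly_function_det) (auto simp: V_def)
  moreover
  \<comment> \<open>The combination with index \<open>i\<close> is specialised to its term at the
    selected index of position \<open>i - 1\<close>.\<close>
  define b\<^sub>0 where "b\<^sub>0 = (\<lambda>(i, j). if j = e (i - 1) then 1 else 0 :: 'k)"
  have "det (A b\<^sub>0) \<in> R - M"
  proof -
    have entry: "A b\<^sub>0 $$ (i, s) = (if s = i then u (Suc i) (e i) else 0)" if "i < m" "s < m" for i s
    proof -
      have "A b\<^sub>0 $$ (i, s) = (\<Sum>j\<in>{Suc i..r}. \<iota> (if j = e i then 1 else 0) * (u (Suc i) j * N j s))"
        using that by (simp add: A_def b\<^sub>0_def)
      also have "\<dots> = (\<Sum>j\<in>{Suc i..r}. if j = e i then u (Suc i) j * N j s else 0)"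
        by (intro sum.cong) (auto simp: \<iota>_one \<iota>_zero)
      \<comment> \<open>By \<open>e_ge\<close> the index \<open>e i\<close> lies in the range of
        summation; otherwise the entry would vanish.\<close>
      also have "\<dots> = u (Suc i) (e i) * N (e i) s"
        using that e_ge[of i] e_r[of i] by simp
      finally show ?thesis using that N(3) by simp
    qed
    have "upper_triangular (A b\<^sub>0)" using carr entry by (auto simp: A_def upper_triangular_def)
    then have "det (A b\<^sub>0) = prod_list (diag_mat (A b\<^sub>0))"
      using carr by (rule det_upper_triangular)
    also have "\<dots> = (\<Prod>i = 0..<m. A b\<^sub>0 $$ (i, i))"
      using carr[of b\<^sub>0] by (simp add: prod_list_diag_prod)
    also have "\<dots> \<in> R - M"
    proof (rule nonM_prod)
      fix i assume "i \<in> {0..<m}"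
      then show "A b\<^sub>0 $$ (i, i) \<in> R - M"
        using entry[of i i] e_ge[of i] e_r[of i] u[of "Suc i" "e i"] m by auto
    qed
    finally show ?thesis .
  qed
  then have "det (A b\<^sub>0) \<notin> M" by blast
  ultimately obtain P where P: "P \<noteq> 0" "P \<in> mpoly_over V"
      "\<And>b. eval_mpoly P b \<noteq> 0 \<Longrightarrow> det (A b) \<notin> M"
    using generic_polynomial by blast
  show ?thesis
  proof (rule that[OF P(1)])
    show "P \<in> mpoly_over {(i, j). 1 \<le> i \<and> i \<le> c \<and> i \<le> j \<and> j \<le> r}"
      using P(2) by (simp add: V_def)
    fix b assume "eval_mpoly P b \<noteq> 0"
    then have det: "det (A b) \<notin> M" by (rule P(3))
    have "\<phi> (e s) \<in> lin_comb R ((\<lambda>i. \<psi> b (Suc i)) ` {..<m})" if "s < m" for s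
      using generators_from_det[OF carr A_R det, of "\<lambda>i. \<psi> b (Suc i)" "\<lambda>s. \<phi> (e s)" s] \<psi>_A that
      by simp
    \<comment> \<open>The combinations with index above \<open>m\<close> can only enlarge the
      span.\<close>
    moreover have "(\<lambda>i. \<psi> b (Suc i)) ` {..<m} \<subseteq> \<psi> b ` {1..c}" using m by auto
    ultimately have "S \<subseteq> lin_comb R (\<psi> b ` {1..c})"
      unfolding img[symmetric] using lin_comb_mono by blast
    then have "lin_comb R (\<phi> ` {1..r}) \<subseteq> lin_comb R (\<psi> b ` {1..c})"
      unfolding S(4)[symmetric] by (rule lin_comb_trans)
    then show "lin_comb R (\<phi> ` {1..r}) \<subseteq>
        lin_comb R ((\<lambda>i. \<Sum>j=i..r. \<iota> (b (i, j)) * u i j * \<phi> j) ` {1..c})"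
      by (simp only: \<psi>_def[abs_def])
  qed
qed

end

section \<open>Homogeneous parts\<close>

lemma comm_subring_mpoly_over: "comm_subring (mpoly_over V :: ('v, 'k::comm_ring_1) mpoly set)"
proof
  show "1 \<in> (mpoly_over V :: ('v, 'k) mpoly set)" by (simp add: mpoly_over_def)
  show "- p \<in> mpoly_over V" if "p \<in> mpoly_over V" for p :: "('v, 'k) mpoly"
  proof -
    have "Poly_Mapping.keys (- p) = Poly_Mapping.keys p" by (auto simp: in_keys_iff)
    then show ?thesis using that by (simp add: mpoly_over_def)
  qed
qed (auto intro: mpoly_over_add mpoly_over_mult)

lemma coord_ring_eq: "coord_ring n = as_ring (mpoly_over {..n})"
  by (simp add: coord_ring_def as_ring_def)

lemma carrier_coord_ring [simp]: "carrier (coord_ring n) = mpoly_over {..n}"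
  by (simp add: coord_ring_def)

lemma monom_degree_add: "monom_degree (m + m') = monom_degree m + monom_degree m'"
proof -
  have *: "monom_degree m = (\<Sum>v\<in>A. Poly_Mapping.lookup m v)"
    if "finite A" "Poly_Mapping.keys m \<subseteq> A" for A and m :: "'a \<Rightarrow>\<^sub>0 nat"
    unfolding monom_degree_def
    using that by (intro sum.mono_neutral_left) (auto simp: in_keys_iff)
  let ?A = "Poly_Mapping.keys m \<union> Poly_Mapping.keys m'"
  have "Poly_Mapping.keys (m + m') \<subseteq> ?A" by (rule Poly_Mapping.keys_add)
  then show ?thesis
    by (subst (1 2 3) *[of ?A]) (simp_all add: lookup_add sum.distrib)
qed

lemma forms_zero: "0 \<in> forms n e"
  by (simp add: forms_def)

lemma forms_add: "p \<in> forms n e \<Longrightarrow> q \<in> forms n e \<Longrightarrow> p + q \<in> forms n e"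
  unfolding forms_def using Poly_Mapping.keys_add[of p q] by (auto intro: mpoly_over_add)

lemma forms_sum: "(\<And>i. i \<in> A \<Longrightarrow> g i \<in> forms n e) \<Longrightarrow> (\<Sum>i\<in>A. g i) \<in> forms n e"
  by (induction A rule: infinite_finite_induct) (auto intro: forms_zero forms_add)

lemma forms_mult:
  assumes "p \<in> forms n d" "q \<in> forms n e"
  shows "p * q \<in> forms n (d + e)"
proof -
  have "monom_degree m = d + e" if m: "m \<in> Poly_Mapping.keys (p * q)" for m
  proof -
    from m obtain a c where "m = a + c" "a \<in> Poly_Mapping.keys p" "c \<in> Poly_Mapping.keys q"
      using keys_mult[of p q] by blast
    then show ?thesis using assms by (simp add: monom_degree_add forms_def)
  qed
  then show ?thesis using assms by (simp add: forms_def mpoly_over_mult)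
qed

lemma forms_Const: "Const c \<in> forms n 0"
  by (auto simp: forms_def Const_def mpoly_over_def monom_degree_def)

lemma forms_one: "1 \<in> forms n 0"
  using forms_Const[of 1 n] by (simp add: Const_def)

lemma forms_power: "p \<in> forms n 1 \<Longrightarrow> p ^ k \<in> forms n k"
proof (induction k)
  case (Suc k)
  then show ?case using forms_mult[of p n 1 "p ^ k" k] by simp
qed (simp add: forms_one)

definition homogeneous_part :: "nat \<Rightarrow> (nat, 'k::field) mpoly \<Rightarrow> (nat, 'k) mpoly" where
  "homogeneous_part e = Poly_Mapping.mapp (\<lambda>m c. if monom_degree m = e then c else 0)"

lemma lookup_homogeneous_part:
  "Poly_Mapping.lookup (homogeneous_part e p) m =
     (if monom_degree m = e then Poly_Mapping.lookup p m else 0)"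
  by (simp add: homogeneous_part_def lookup_mapp when_def in_keys_iff)

lemma homogeneous_part_add:
  "homogeneous_part e (p + q) = homogeneous_part e p + homogeneous_part e q"
  by (intro poly_mapping_eqI) (simp add: lookup_homogeneous_part lookup_add)

lemma homogeneous_part_zero [simp]: "homogeneous_part e 0 = 0"
  by (intro poly_mapping_eqI) (simp add: lookup_homogeneous_part)

lemma homogeneous_part_sum:
  "homogeneous_part e (\<Sum>i\<in>A. g i) = (\<Sum>i\<in>A. homogeneous_part e (g i))"
  by (induction A rule: infinite_finite_induct) (auto simp: homogeneous_part_add)

lemma homogeneous_part_form:
  assumes "\<And>m. m \<in> Poly_Mapping.keys p \<Longrightarrow> monom_degree m = d"
  shows "homogeneous_part e p = (if d = e then p else 0)"
  using assms by (intro poly_mapping_eqI) (force simp: lookup_homogeneous_part in_keys_iff)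

lemma homogeneous_part_in_forms: "p \<in> mpoly_over {..n} \<Longrightarrow> homogeneous_part e p \<in> forms n e"
  by (auto simp: forms_def mpoly_over_def in_keys_iff lookup_homogeneous_part split: if_splits)

text \<open>Multiplication by a form of degree \<open>d\<close> raises degrees by \<open>d\<close>.
  The case distinction guards against truncated subtraction: for \<open>e\<close> below
  \<open>d\<close> there is no part of degree \<open>e\<close>.\<close>

lemma homogeneous_part_mult:
  assumes "f \<in> forms n d"
  shows "homogeneous_part e (p * f) = (if d \<le> e then homogeneous_part (e - d) p * f else 0)"
proof (induction p rule: poly_mapping_add_induct)
  case (add m c p)
  have "monom_degree l = monom_degree m + d" if l: "l \<in> Poly_Mapping.keys (Poly_Mapping.single m c * f)" for l
  proof -
    from l obtain a where "l = m + a" "a \<in> Poly_Mapping.keys f"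
      using keys_mult[of "Poly_Mapping.single m c" f] by (force split: if_splits)
    then show ?thesis using assms by (simp add: monom_degree_add forms_def)
  qed
  then have "homogeneous_part e (Poly_Mapping.single m c * f) =
      (if monom_degree m + d = e then Poly_Mapping.single m c * f else 0)"
    by (rule homogeneous_part_form)
  moreover have "homogeneous_part (e - d) (Poly_Mapping.single m c) =
      (if monom_degree m = e - d then Poly_Mapping.single m c else 0)"
    by (rule homogeneous_part_form) (auto split: if_splits)
  ultimately show ?case
    using add by (auto simp: distrib_right homogeneous_part_add)
qed auto

section \<open>The local ring at a point\<close>

lemma Fract_add_same: "b \<noteq> 0 \<Longrightarrow> Fract (a + c) b = Fract a b + Fract c b"
  by (simp add: eq_fract algebra_simps)

lemma Fract_sum:
  assumes "b \<noteq> 0"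
  shows "Fract (\<Sum>i\<in>A. g i) b = (\<Sum>i\<in>A. Fract (g i) b)"
  by (induction A rule: infinite_finite_induct) (auto simp: Fract_add_same[OF assms] fract_collapse)

locale proj_prime =
  fixes n :: nat and \<eta> :: "(nat, 'k::field) mpoly set"
  assumes prime: "primeideal \<eta> (coord_ring n)"
begin

sublocale coord: comm_subring "mpoly_over {..n} :: (nat, 'k) mpoly set"
  by (rule comm_subring_mpoly_over)

lemma ideal_\<eta>: "ideal \<eta> (coord_ring n)"
  using prime by (rule primeideal.axioms)

lemma ring_coord_ring: "ring (coord_ring n :: (nat, 'k) mpoly ring)"
  unfolding coord_ring_eq by (rule cring.axioms(1)[OF coord.cring_as_ring])

lemma ideal_Idl: "S \<subseteq> mpoly_over {..n} \<Longrightarrow> ideal (Idl\<^bsub>coord_ring n\<^esub> S) (coord_ring n)"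
  for S :: "(nat, 'k) mpoly set"
  by (rule ring.genideal_ideal[OF ring_coord_ring]) simp

lemmas idealD = coord.ideal_as_ringD[folded coord_ring_eq]

lemma zero_in_\<eta>: "0 \<in> \<eta>"
  using idealD(2)[OF ideal_\<eta>] .

lemma one_notin_\<eta>: "1 \<notin> \<eta>"
proof
  assume "1 \<in> \<eta>"
  then have "mpoly_over {..n} \<subseteq> \<eta>" using idealD(4)[OF ideal_\<eta>, of _ 1] by auto
  then have "mpoly_over {..n} = \<eta>" using idealD(1)[OF ideal_\<eta>] by blast
  then show False using primeideal.I_notcarr[OF prime] by simp
qed

lemma forms_carrier: "p \<in> forms n e \<Longrightarrow> p \<in> mpoly_over {..n}"
  by (simp add: forms_def)

lemma mult_notin_\<eta>:
  "p \<in> forms n d \<Longrightarrow> q \<in> forms n e \<Longrightarrow> p \<notin> \<eta> \<Longrightarrow> q \<notin> \<eta> \<Longrightarrow> p * q \<notin> \<eta>"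
  using primeideal.I_prime[OF prime, of p q] by (auto simp: coord_ring_def forms_def)

lemma power_notin_\<eta>: "p \<in> forms n 1 \<Longrightarrow> p \<notin> \<eta> \<Longrightarrow> p ^ k \<notin> \<eta>"
proof (induction k)
  case (Suc k)
  then show ?case using mult_notin_\<eta>[of p 1 "p ^ k" k] forms_power[of p n k] by simp
qed (simp add: one_notin_\<eta>)

lemma stalkI: "a \<in> J \<Longrightarrow> a \<in> forms n e \<Longrightarrow> b \<in> forms n e \<Longrightarrow> b \<notin> \<eta> \<Longrightarrow> Fract a b \<in> ideal_stalk n J \<eta>"
  unfolding ideal_stalk_def by blast

lemma stalkE:
  assumes "x \<in> ideal_stalk n J \<eta>"
  obtains a b e where "x = Fract a b" "a \<in> J" "a \<in> forms n e" "b \<in> forms n e" "b \<notin> \<eta>" "b \<noteq> 0"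
  using assms zero_in_\<eta> unfolding ideal_stalk_def by blast

lemma stalk_mono: "J \<subseteq> K \<Longrightarrow> ideal_stalk n J \<eta> \<subseteq> ideal_stalk n K \<eta>"
  unfolding ideal_stalk_def by blast

abbreviation "local_ring \<equiv> ideal_stalk n (mpoly_over {..n}) \<eta>"

lemma stalk_zero: "0 \<in> J \<Longrightarrow> 0 \<in> ideal_stalk n J \<eta>"
  unfolding Zero_fract_def by (rule stalkI[of _ _ 0]) (auto simp: forms_zero forms_one one_notin_\<eta>)

text \<open>Over the common denominator both numerators have degree \<open>e + e'\<close>, and
  primality keeps the denominator outside \<eta>.\<close>

lemma stalk_add:
  assumes J: "ideal J (coord_ring n)" and x: "x \<in> ideal_stalk n J \<eta>" and y: "y \<in> ideal_stalk n J \<eta>"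
  shows "x + y \<in> ideal_stalk n J \<eta>"
proof -
  obtain a b e where a: "x = Fract a b" "a \<in> J" "a \<in> forms n e" "b \<in> forms n e" "b \<notin> \<eta>" "b \<noteq> 0"
    using x by (rule stalkE)
  obtain c d e' where c: "y = Fract c d" "c \<in> J" "c \<in> forms n e'" "d \<in> forms n e'" "d \<notin> \<eta>" "d \<noteq> 0"
    using y by (rule stalkE)
  have "a * d \<in> J" "c * b \<in> J"
    using idealD(4)[OF J forms_carrier[OF c(4)] a(2)] idealD(4)[OF J forms_carrier[OF a(4)] c(2)]
    by (simp_all add: mult.commute)
  then have "a * d + c * b \<in> J" using idealD(3)[OF J] by blast
  moreover have "a * d \<in> forms n (e + e')" "c * b \<in> forms n (e + e')" "b * d \<in> forms n (e + e')"
    using a c forms_mult[of a n e d e'] forms_mult[of c n e' b e] forms_mult[of b n e d e']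
    by (simp_all add: add.commute)
  moreover have "b * d \<notin> \<eta>" using a c mult_notin_\<eta> by blast
  ultimately show ?thesis
    using a c by (simp add: stalkI[of _ _ "e + e'"] forms_add)
qed

lemma stalk_mult:
  assumes J: "ideal J (coord_ring n)" and x: "x \<in> local_ring" and y: "y \<in> ideal_stalk n J \<eta>"
  shows "x * y \<in> ideal_stalk n J \<eta>"
proof -
  obtain a b e where a: "x = Fract a b" "a \<in> mpoly_over {..n}" "a \<in> forms n e" "b \<in> forms n e" "b \<notin> \<eta>"
    using x by (rule stalkE)
  obtain c d e' where c: "y = Fract c d" "c \<in> J" "c \<in> forms n e'" "d \<in> forms n e'" "d \<notin> \<eta>"
    using y by (rule stalkE)
  have "a * c \<in> J" using a c idealD(4)[OF J] by blast
  then have "Fract (a * c) (b * d) \<in> ideal_stalk n J \<eta>"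
    using a c forms_mult mult_notin_\<eta> by (intro stalkI[of _ _ "e + e'"]) auto
  then show ?thesis using a c by simp
qed

lemma ideal_carrier: "ideal (mpoly_over {..n} :: (nat, 'k) mpoly set) (coord_ring n)"
  using ring.oneideal[OF ring_coord_ring] by simp

text \<open>The maximal ideal is the stalk of \<eta> itself: a fraction outside it has its numerator
  outside \<eta>, so its reciprocal is again an admissible fraction of degree zero.\<close>

sublocale loc: local_algebra local_ring "ideal_stalk n \<eta> \<eta>" "\<lambda>c. Fract (Const c) 1"
proof
  show one: "1 \<in> local_ring"
    unfolding One_fract_def
    by (rule stalkI[of _ _ 0]) (auto simp: forms_one one_notin_\<eta> coord.one_closed)
  have const: "Fract (Const c) 1 \<in> local_ring" for c
    using forms_Const[of c n] forms_carrier
    by (intro stalkI[of _ _ 0]) (auto simp: forms_one one_notin_\<eta>)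
  then show "Fract (Const c) 1 \<in> local_ring" for c .
  show "x + y \<in> local_ring" if "x \<in> local_ring" "y \<in> local_ring" for x y
    using that by (rule stalk_add[OF ideal_carrier])
  show mult: "x * y \<in> local_ring" if "x \<in> local_ring" "y \<in> local_ring" for x y
    using that by (rule stalk_mult[OF ideal_carrier])
  show "- x \<in> local_ring" if "x \<in> local_ring" for x
  proof -
    have "Fract (Const (-1)) 1 = (-1 :: (nat, 'k) mpoly fract)"
      by (simp add: Const_def single_uminus One_fract_def)
    then show ?thesis using mult[OF const[of "-1"] that] by simp
  qed
  show "ideal_stalk n \<eta> \<eta> \<subseteq> local_ring"
    by (rule stalk_mono[OF idealD(1)[OF ideal_\<eta>]])
  show "0 \<in> ideal_stalk n \<eta> \<eta>" by (rule stalk_zero[OF zero_in_\<eta>])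
  show "x + y \<in> ideal_stalk n \<eta> \<eta>" if "x \<in> ideal_stalk n \<eta> \<eta>" "y \<in> ideal_stalk n \<eta> \<eta>" for x y
    using that by (rule stalk_add[OF ideal_\<eta>])
  show "x * y \<in> ideal_stalk n \<eta> \<eta>" if "x \<in> local_ring" "y \<in> ideal_stalk n \<eta> \<eta>" for x y
    using that by (rule stalk_mult[OF ideal_\<eta>])
  show "1 \<notin> ideal_stalk n \<eta> \<eta>"
  proof
    assume "1 \<in> ideal_stalk n \<eta> \<eta>"
    then obtain a b e where "1 = Fract a b" "a \<in> \<eta>" "b \<notin> \<eta>" "b \<noteq> 0" by (rule stalkE)
    then show False by (simp add: One_fract_def eq_fract)
  qed
  show "inverse x \<in> local_ring" if x: "x \<in> local_ring" and notin: "x \<notin> ideal_stalk n \<eta> \<eta>" for x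
  proof -
    obtain a b e where a: "x = Fract a b" "a \<in> forms n e" "b \<in> forms n e" "b \<notin> \<eta>"
      using x by (rule stalkE)
    then have "a \<notin> \<eta>" using notin stalkI by blast
    then have "Fract b a \<in> local_ring" using a forms_carrier by (intro stalkI[of _ _ e]) auto
    then show ?thesis using a by simp
  qed
  show "Fract (Const (x + y)) 1 = Fract (Const x) 1 + Fract (Const y) 1" for x y :: 'k
    by (simp add: Const_def single_add)
  show "Fract (Const (x * y)) 1 = Fract (Const x) 1 * Fract (Const y) 1" for x y :: 'k
    by (simp add: Const_def mult_single)
  show "Fract (Const 1) 1 = (1 :: (nat, 'k) mpoly fract)"
    by (simp add: Const_def One_fract_def)
qed

lemma proj_local_ring_eq: "proj_local_ring n \<eta> = as_ring local_ring"
  by (simp add: proj_local_ring_def as_ring_def)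

lemma lin_comb_stalk:
  assumes J: "ideal J (coord_ring n)" and S: "S \<subseteq> ideal_stalk n J \<eta>"
  shows "lin_comb local_ring S \<subseteq> ideal_stalk n J \<eta>"
proof
  fix x assume "x \<in> lin_comb local_ring S"
  then show "x \<in> ideal_stalk n J \<eta>"
    by (induction rule: lin_comb.induct)
      (use S in \<open>auto intro: stalk_zero idealD(2)[OF J] stalk_add[OF J] stalk_mult[OF J]\<close>)
qed

text \<open>Taking homogeneous parts makes the coefficients of a form with respect to
  homogeneous generators homogeneous; a form \<open>\<ell>\<close> not vanishing at \<open>\<eta>\<close> then adjusts the degrees.\<close>

lemma stalk_eq_lin_comb:
  assumes gens: "homogeneous_generators n I r f dg" and l: "l \<in> forms n 1" "l \<notin> \<eta>"
  shows "ideal_stalk n I \<eta> = lin_comb local_ring ((\<lambda>j. Fract (f j) (l ^ dg j)) ` {1..r})"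
proof
  have f: "f j \<in> forms n (dg j)" if "j \<in> {1..r}" for j
    using gens that by (simp add: homogeneous_generators_def)
  then have f_carrier: "f ` {1..r} \<subseteq> mpoly_over {..n}" using forms_carrier by blast
  have I_Idl: "I = Idl\<^bsub>coord_ring n\<^esub> (f ` {1..r})"
    using gens by (simp add: homogeneous_generators_def)
  then have I: "I = lin_comb (mpoly_over {..n}) (f ` {1..r})"
    unfolding coord_ring_eq by (simp only: coord.genideal_as_ring[OF f_carrier])
  have ideal_I: "ideal I (coord_ring n)"
    unfolding I_Idl by (rule ideal_Idl[OF f_carrier])
  have l_nz: "l ^ k \<noteq> 0" for k using power_notin_\<eta>[OF l, of k] zero_in_\<eta> by metis
  have "Fract (f j) (l ^ dg j) \<in> ideal_stalk n I \<eta>" if "j \<in> {1..r}" for j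
  proof (rule stalkI)
    show "f j \<in> I" unfolding I using that by (intro coord.lin_comb_base) auto
  qed (use f that in \<open>auto simp: forms_power[OF l(1)] power_notin_\<eta>[OF l]\<close>)
  then show "lin_comb local_ring ((\<lambda>j. Fract (f j) (l ^ dg j)) ` {1..r}) \<subseteq> ideal_stalk n I \<eta>"
    by (intro lin_comb_stalk[OF ideal_I]) auto
  show "ideal_stalk n I \<eta> \<subseteq> lin_comb local_ring ((\<lambda>j. Fract (f j) (l ^ dg j)) ` {1..r})"
  proof
    fix x assume "x \<in> ideal_stalk n I \<eta>"
    then obtain a b e where x: "x = Fract a b" "a \<in> I" "a \<in> forms n e" "b \<in> forms n e" "b \<notin> \<eta>" "b \<noteq> 0"
      by (rule stalkE)
    obtain c where c: "\<And>j. j \<in> {1..r} \<Longrightarrow> c j \<in> mpoly_over {..n}" "a = (\<Sum>j\<in>{1..r}. c j * f j)"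
      using x(2) unfolding I by (rule coord.lin_comb_imageE) auto
    \<comment> \<open>A generator of degree above \<open>e\<close> contributes nothing in degree
      \<open>e\<close>, hence the default 0.\<close>
    define h where "h j = (if dg j \<le> e then homogeneous_part (e - dg j) (c j) else 0)" for j
    have h: "h j * l ^ dg j \<in> forms n e" if "j \<in> {1..r}" for j
    proof (cases "dg j \<le> e")
      case True
      then show ?thesis
        using forms_mult[OF homogeneous_part_in_forms[OF c(1)[OF that], of "e - dg j"] forms_power[OF l(1), of "dg j"]]
        by (simp add: h_def)
    qed (simp add: h_def forms_zero)
    have "a = homogeneous_part e a"
      using x(3) by (simp add: forms_def homogeneous_part_form[of a e])
    also have "\<dots> = (\<Sum>j\<in>{1..r}. h j * f j)"
      unfolding c(2) homogeneous_part_sum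
      by (intro sum.cong) (auto simp: h_def homogeneous_part_mult[OF f])
    finally have "x = (\<Sum>j\<in>{1..r}. Fract (h j * f j) b)"
      by (simp only: x(1) Fract_sum[OF x(6)])
    \<comment> \<open>Expanding by \<open>l ^ dg j\<close> splits each summand into two fractions of
      degree zero: a coefficient in the local ring and a local generator.\<close>
    also have "\<dots> = (\<Sum>j\<in>{1..r}. Fract (h j * l ^ dg j) b * Fract (f j) (l ^ dg j))"
      using x(6) l_nz by (intro sum.cong) (auto simp: eq_fract mult_ac)
    also have "\<dots> \<in> lin_comb local_ring ((\<lambda>j. Fract (f j) (l ^ dg j)) ` {1..r})"
    proof (intro lin_comb_sum loc.lin_comb_mult loc.lin_comb_base)
      fix j assume j: "j \<in> {1..r}"
      show "Fract (h j * l ^ dg j) b \<in> local_ring"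
        using h[OF j] x forms_carrier by (intro stalkI[of _ _ e]) auto
    qed auto
    finally show "x \<in> lin_comb local_ring ((\<lambda>j. Fract (f j) (l ^ dg j)) ` {1..r})" .
  qed
qed

text \<open>Degrees do not increase along the generators, so \<open>dg i - dg j\<close> is a true
  difference and each summand has degree \<open>dg i\<close>. For \<open>i > r\<close> the sum is
  empty, hence the guard on \<open>L\<close>.\<close>

lemma CI_form_in_forms:
  assumes gens: "homogeneous_generators n I r f dg"
    and L: "i \<le> r \<Longrightarrow> L (if i = 1 then 1 else i - 1) \<in> forms n 1" and "1 \<le> i"
  shows "CI_form r f dg L b i \<in> forms n (dg i)"
  unfolding CI_form_def
proof (rule forms_sum)
  fix j assume j: "j \<in> {i..r}"
  then have "f j \<in> forms n (dg j)" "dg j \<le> dg i"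
    using gens \<open>1 \<le> i\<close> by (auto simp: homogeneous_generators_def)
  moreover have "L (if i = 1 then 1 else i - 1) ^ (dg i - dg j) \<in> forms n (dg i - dg j)"
    using L j by (intro forms_power) auto
  then have "Const (b (i, j)) * L (if i = 1 then 1 else i - 1) ^ (dg i - dg j) \<in> forms n (0 + (dg i - dg j))"
    by (intro forms_mult forms_Const)
  ultimately show "Const (b (i, j)) * L (if i = 1 then 1 else i - 1) ^ (dg i - dg j) * f j \<in> forms n (dg i)"
    using forms_mult by fastforce
qed

text \<open>Dividing by powers of a fixed linear form \<open>l\<close> turns the form \<open>F\<^sub>i\<close> into a combination
  of local generators whose coefficients are \<open>b\<^bsub>i,j\<^esub>\<close> times a unit.\<close>

lemma Fract_CI_form:
  assumes dg: "\<And>j. j \<in> {i..r} \<Longrightarrow> dg j \<le> dg i" and l: "\<And>k. l ^ k \<noteq> 0"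
  shows "Fract (CI_form r f dg L b i) (l ^ dg i) =
    (\<Sum>j=i..r. Fract (Const (b (i, j))) 1 *
       Fract (L (if i = 1 then 1 else i - 1) ^ (dg i - dg j)) (l ^ (dg i - dg j)) *
       Fract (f j) (l ^ dg j))"
  unfolding CI_form_def Fract_sum[OF l]
proof (intro sum.cong refl)
  fix j assume "j \<in> {i..r}"
  then have "l ^ dg i = l ^ (dg i - dg j) * l ^ dg j"
    using dg[of j] by (simp flip: power_add)
  then show "Fract (Const (b (i, j)) * L (if i = 1 then 1 else i - 1) ^ (dg i - dg j) * f j) (l ^ dg i) =
      Fract (Const (b (i, j))) 1 *
       Fract (L (if i = 1 then 1 else i - 1) ^ (dg i - dg j)) (l ^ (dg i - dg j)) *
       Fract (f j) (l ^ dg j)"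
    by simp
qed

end

section \<open>Equality of the stalks of X and Z at a generic point\<close>

theorem proposition6p2:
  fixes n d r :: nat
    and I :: "(nat, 'k::alg_closed_field) mpoly set"
    and f L :: "nat \<Rightarrow> (nat, 'k) mpoly"
    and dg :: "nat \<Rightarrow> nat"
    and C :: "(nat, 'k) mpoly set set"
    and \<eta> :: "(nat, 'k) mpoly set"
  assumes "d < n"
    and "closed_subscheme n I"
    and "cohen_macaulay_scheme n I"
    and "pure_dimensional n I d"
    and "generically_complete_intersection n d I"
    and "homogeneous_generators n I r f dg"
    and "\<forall>i\<in>{1..n-d-1}. L i \<in> forms n 1"
    and "irreducible_component n I C"
    and "is_generic_point n C \<eta>"
    and general_linear_forms: "\<forall>i\<in>{1..n-d-1}. L i \<notin> \<eta>"
  shows "\<exists>P :: (nat \<times> nat, 'k) mpoly.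
           P \<noteq> 0 \<and> P \<in> mpoly_over (coeff_indices n d r) \<and>
           (\<forall>b. admissible_choice n d r f dg L b \<and> eval_mpoly P b \<noteq> 0 \<longrightarrow>
                ideal_stalk n (CI_ideal n d I r f dg L b) \<eta> = ideal_stalk n I \<eta>)"
proof (cases "n = d + 1")
  case True
  \<comment> \<open>Here \<open>CI_ideal\<close> is \<open>I\<close> by definition, so the constant
    polynomial 1 will do.\<close>
  then show ?thesis
    by (intro exI[of _ 1]) (auto simp: CI_ideal_def mpoly_over_def)
next
  case False
  \<comment> \<open>Now n \<ge> d + 2, so \<open>L 1\<close> is among the given linear forms and its
    powers can serve as denominators.\<close>
  then have nd: "1 \<in> {1..n-d-1}" using \<open>d < n\<close> by auto
  have "\<eta> \<in> vanishing_locus n I"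
    using assms(8,9) unfolding irreducible_component_def is_generic_point_def by blast
  then interpret proj_prime n \<eta>
    by (intro proj_prime.intro) (simp add: vanishing_locus_def proj_points_def)
  note gens = assms(6)
  define l where "l = L 1"
  have l: "l \<in> forms n 1" "l \<notin> \<eta>" using nd assms(7) general_linear_forms by (auto simp: l_def)
  have l_nz: "l ^ k \<noteq> 0" for k using power_notin_\<eta>[OF l, of k] zero_in_\<eta> by metis
  have dg: "dg j \<le> dg i" if "1 \<le> i" "j \<in> {i..r}" for i j
    using gens that by (simp add: homogeneous_generators_def)
  have f: "f j \<in> forms n (dg j)" if "j \<in> {1..r}" for j
    using gens that by (simp add: homogeneous_generators_def)
  have Li: "L (if i = 1 then 1 else i - 1) \<in> forms n 1" "L (if i = 1 then 1 else i - 1) \<notin> \<eta>"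
    if "i \<in> {1..n-d}" for i
  proof -
    \<comment> \<open>The first form shares \<open>L 1\<close> with the second, so n - d - 1 linear
      forms suffice for n - d forms.\<close>
    have "(if i = 1 then 1 else i - 1) \<in> {1..n-d-1}" using that nd by auto
    then show "L (if i = 1 then 1 else i - 1) \<in> forms n 1" "L (if i = 1 then 1 else i - 1) \<notin> \<eta>"
      using assms(7) general_linear_forms by blast+
  qed
  define \<phi> where "\<phi> j = Fract (f j) (l ^ dg j)" for j
  define u where "u i j = Fract (L (if i = 1 then 1 else i - 1) ^ (dg i - dg j)) (l ^ (dg i - dg j))"
    for i j
  have I: "ideal I (coord_ring n)"
    using assms(2) by (simp add: closed_subscheme_def homogeneous_ideal_def)
  have stalk_I: "ideal_stalk n I \<eta> = lin_comb local_ring (\<phi> ` {1..r})"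
    unfolding \<phi>_def by (rule stalk_eq_lin_comb[OF gens l])
  obtain gs where gs: "length gs = n - d" "set gs \<subseteq> local_ring"
      "ideal_stalk n I \<eta> = Idl\<^bsub>proj_local_ring n \<eta>\<^esub> (set gs)"
  proof -
    have "carrier (proj_local_ring n \<eta>) = local_ring" by (simp add: proj_local_ring_def)
    with assms(5,8,9) that show thesis unfolding generically_complete_intersection_def by metis
  qed
  have gs_lin_comb: "lin_comb local_ring (set gs) = lin_comb local_ring (\<phi> ` {1..r})"
    using gs(3) unfolding proj_local_ring_eq loc.genideal_as_ring[OF gs(2)] stalk_I by simp
  obtain P :: "(nat \<times> nat, 'k) mpoly" where P: "P \<noteq> 0"
      "P \<in> mpoly_over {(i, j). 1 \<le> i \<and> i \<le> n - d \<and> i \<le> j \<and> j \<le> r}"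
      "\<And>b. eval_mpoly P b \<noteq> 0 \<Longrightarrow> lin_comb local_ring (\<phi> ` {1..r}) \<subseteq>
         lin_comb local_ring ((\<lambda>i. \<Sum>j=i..r. Fract (Const (b (i, j))) 1 * u i j * \<phi> j) ` {1..n-d})"
  proof (rule loc.generic_generators[of r \<phi> "set gs" "n - d" u])
    show "\<phi> j \<in> local_ring" if "j \<in> {1..r}" for j
      unfolding \<phi>_def using f[OF that] forms_carrier
      by (intro stalkI[of _ _ "dg j"]) (auto simp: forms_power[OF l(1)] power_notin_\<eta>[OF l])
    show "u i j \<in> local_ring - ideal_stalk n \<eta> \<eta>" if "i \<in> {1..n-d}" for i j
    proof -
      let ?p = "L (if i = 1 then 1 else i - 1) ^ (dg i - dg j)" and ?q = "l ^ (dg i - dg j)"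
      have p: "?p \<in> forms n (dg i - dg j)" "?p \<notin> \<eta>"
        using forms_power[OF Li(1)] power_notin_\<eta>[OF Li] that by blast+
      have q: "?q \<in> forms n (dg i - dg j)" "?q \<notin> \<eta>"
        using forms_power[OF l(1)] power_notin_\<eta>[OF l] by blast+
      \<comment> \<open>The reciprocal lies in the local ring as well, so membership of
        \<open>u i j\<close> in the maximal ideal would put 1 there.\<close>
      have "u i j * Fract ?q ?p = 1"
      proof -
        have "?p * ?q \<noteq> 0" using p q zero_in_\<eta> by (metis mult_eq_0_iff)
        then show ?thesis by (simp add: u_def One_fract_def eq_fract mult.commute)
      qed
      moreover have "Fract ?q ?p \<in> local_ring"
        using p q forms_carrier by (intro stalkI) auto
      ultimately have "u i j \<notin> ideal_stalk n \<eta> \<eta>"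
        using loc.M_mult[of "Fract ?q ?p" "u i j"] loc.M_one by (auto simp: mult.commute)
      moreover have "u i j \<in> local_ring"
        unfolding u_def using p q forms_carrier by (intro stalkI) auto
      ultimately show ?thesis by blast
    qed
    show "card (set gs) \<le> n - d" using card_length[of gs] gs(1) by simp
  qed (use gs_lin_comb in auto)
  show ?thesis
  proof (intro exI[of _ P] conjI allI impI)
    show "P \<noteq> 0" by (rule P(1))
    show "P \<in> mpoly_over (coeff_indices n d r)" using P(2) by (simp add: coeff_indices_def)
    fix b assume b: "admissible_choice n d r f dg L b \<and> eval_mpoly P b \<noteq> 0"
    let ?F = "CI_form r f dg L b"
    define Z where "Z = CI_ideal n d I r f dg L b"
    have F_forms: "?F i \<in> forms n (dg i)" if "i \<in> {1..n-d}" for i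
      using CI_form_in_forms[OF gens] Li(1)[OF that] that by auto
    then have F_carrier: "?F ` {1..n-d} \<subseteq> mpoly_over {..n}" using forms_carrier by blast
    have Z: "Z = Idl\<^bsub>coord_ring n\<^esub> (?F ` {1..n-d})"
      using False by (simp add: Z_def CI_ideal_def)
    then have ideal_Z: "ideal Z (coord_ring n)" using ideal_Idl[OF F_carrier] by simp
    \<comment> \<open>This inclusion is formal: each summand is a multiple of some
      \<open>f j\<close>. The reverse one rests on the nonvanishing of \<open>P\<close>.\<close>
    have "?F i \<in> I" if "i \<in> {1..n-d}" for i
    proof -
      have "Const (b (i, j)) * L (if i = 1 then 1 else i - 1) ^ (dg i - dg j) * f j \<in> I"
        if j: "j \<in> {i..r}" for j
      proof (rule idealD(4)[OF I])
        show "Const (b (i, j)) * L (if i = 1 then 1 else i - 1) ^ (dg i - dg j) \<in> mpoly_over {..n}"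
          using Li(1)[OF \<open>i \<in> {1..n-d}\<close>] forms_Const[of "b (i, j)" n] forms_carrier
          by (intro coord.mult_closed coord.power_closed) auto
        have "j \<in> {1..r}" using j \<open>i \<in> {1..n-d}\<close> by auto
        moreover have "f ` {1..r} \<subseteq> I"
        proof -
          have "f ` {1..r} \<subseteq> mpoly_over {..n}" using f forms_carrier by blast
          then have "f ` {1..r} \<subseteq> Idl\<^bsub>coord_ring n\<^esub> (f ` {1..r})"
            by (intro ring.genideal_self[OF ring_coord_ring]) simp
          then show ?thesis using gens by (simp add: homogeneous_generators_def)
        qed
        ultimately show "f j \<in> I" by blast
      qed
      \<comment> \<open>Passing to arbitrary subsets of the index range makes induction on the index
        set possible.\<close>
      then have "(\<Sum>j\<in>A. Const (b (i, j)) * L (if i = 1 then 1 else i - 1) ^ (dg i - dg j) * f j) \<in> I"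
        if "A \<subseteq> {i..r}" for A
        using that
        by (induction A rule: infinite_finite_induct) (auto intro: idealD(2)[OF I] idealD(3)[OF I])
      then show ?thesis unfolding CI_form_def by blast
    qed
    then have "Z \<subseteq> I"
      unfolding Z by (intro ring.genideal_minimal[OF ring_coord_ring I]) blast
    then have "ideal_stalk n Z \<eta> \<subseteq> ideal_stalk n I \<eta>" by (rule stalk_mono)
    moreover have "ideal_stalk n I \<eta> \<subseteq> ideal_stalk n Z \<eta>"
    proof -
      let ?\<psi> = "\<lambda>i. \<Sum>j=i..r. Fract (Const (b (i, j))) 1 * u i j * \<phi> j"
      have "?\<psi> i \<in> ideal_stalk n Z \<eta>" if i: "i \<in> {1..n-d}" for i
      proof -
        \<comment> \<open>The abstract combination supplied by \<open>generic_generators\<close> is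
          the form \<open>?F i\<close> divided by a power of \<open>l\<close>, which does not vanish
          at \<eta>.\<close>
        have "?\<psi> i = Fract (?F i) (l ^ dg i)"
          unfolding u_def \<phi>_def using dg[of i] i l_nz by (intro Fract_CI_form[symmetric]) auto
        moreover have "?F i \<in> Z"
          unfolding Z using ring.genideal_self[OF ring_coord_ring, of "?F ` {1..n-d}"] F_carrier i
          by auto
        then have "Fract (?F i) (l ^ dg i) \<in> ideal_stalk n Z \<eta>"
          by (intro stalkI[OF _ F_forms[OF i]] forms_power l power_notin_\<eta>)
        ultimately show ?thesis by simp
      qed
      then have "lin_comb local_ring (?\<psi> ` {1..n-d}) \<subseteq> ideal_stalk n Z \<eta>"
        by (intro lin_comb_stalk[OF ideal_Z]) blast
      then show ?thesis using P(3)[of b] b stalk_I by blast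
    qed
    ultimately show "ideal_stalk n (CI_ideal n d I r f dg L b) \<eta> = ideal_stalk n I \<eta>"
      unfolding Z_def by blast
  qed
qed

end
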